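(* Every hole-cyclically orientable graph has a bisimplicial vertex. Moreover, a bisimplicial elimination ordering of a hole-cyclically orientable graph can be computed in linear time.
   Context: Graphs are finite, simple, undirected, with non-empty vertex set. Linear time means time $\mathcal{O}(|V(G)|+|E(G)|)$ for an input graph $G$. An orientation of a graph is a digraph obtained by assigning a direction to each edge. A hole in a graph is a chordless cycle of length at least four. An orientation $D$ of $G$ is hole-cyclic if every hole of $G$ is oriented cyclically in $D$ (i.e., becomes a directed cycle). A graph is hole-cyclically orientable if it admits a hole-cyclic orientation. A vertex $v$ of $G$ is bisimplicial if its neighborhood $N(v)$ is the union of two cliques of $G$. A bisimplicial elimination ordering of $G$ is an ordering $(v_1,\ldots,v_n)$ of the vertices of $G$ such that $v_i$ is bisimplicial in the induced subgraph $G[\{v_1,\ldots,v_i\}]$ for every $i\in\{1,\ldots,n\}$. *)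

theory Defs
  imports Main
begin

section \<open>Graphs\<close>

definition simple_graph :: "'a set \<Rightarrow> 'a set set \<Rightarrow> bool" where
  "simple_graph V E \<longleftrightarrow> finite V \<and> V \<noteq> {} \<and> (\<forall>e\<in>E. e \<subseteq> V \<and> card e = 2)"

definition induced_edges :: "'a set set \<Rightarrow> 'a set \<Rightarrow> 'a set set" where
  "induced_edges E S = {e \<in> E. e \<subseteq> S}"

definition nbhd :: "'a set \<Rightarrow> 'a set set \<Rightarrow> 'a \<Rightarrow> 'a set" where
  "nbhd V E v = {u \<in> V. {u, v} \<in> E}"

text \<open>Cliques may be empty, so isolated and simplicial vertices are bisimplicial.\<close>

definition clique :: "'a set \<Rightarrow> 'a set set \<Rightarrow> 'a set \<Rightarrow> bool" where
  "clique V E K \<longleftrightarrow> K \<subseteq> V \<and> (\<forall>u\<in>K. \<forall>v\<in>K. u \<noteq> v \<longrightarrow> {u, v} \<in> E)"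

definition bisimplicial :: "'a set \<Rightarrow> 'a set set \<Rightarrow> 'a \<Rightarrow> bool" where
  "bisimplicial V E v \<longleftrightarrow>
     v \<in> V \<and> (\<exists>K L. clique V E K \<and> clique V E L \<and> nbhd V E v = K \<union> L)"

definition bisimplicial_elimination_ordering :: "'a set \<Rightarrow> 'a set set \<Rightarrow> 'a list \<Rightarrow> bool" where
  "bisimplicial_elimination_ordering V E vs \<longleftrightarrow>
     distinct vs \<and> set vs = V \<and>
     (\<forall>i\<in>{1..length vs}.
        bisimplicial (set (take i vs)) (induced_edges E (set (take i vs))) (vs ! (i - 1)))"


section \<open>Hole-cyclic orientations\<close>

text \<open>
  A cycle is the list of its vertices in cyclic order; indices are read modulo the length.
\<close>

definition cycle :: "'a set set \<Rightarrow> 'a list \<Rightarrow> bool" where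
  "cycle E vs \<longleftrightarrow> length vs \<ge> 3 \<and> distinct vs \<and>
     (\<forall>i < length vs. {vs ! i, vs ! (Suc i mod length vs)} \<in> E)"

definition cycle_edges :: "'a list \<Rightarrow> 'a set set" where
  "cycle_edges vs = {{vs ! i, vs ! (Suc i mod length vs)} | i. i < length vs}"

definition chordless :: "'a set set \<Rightarrow> 'a list \<Rightarrow> bool" where
  "chordless E vs \<longleftrightarrow> induced_edges E (set vs) \<subseteq> cycle_edges vs"

definition hole :: "'a set set \<Rightarrow> 'a list \<Rightarrow> bool" where
  "hole E vs \<longleftrightarrow> cycle E vs \<and> chordless E vs \<and> length vs \<ge> 4"

definition orientation :: "'a set set \<Rightarrow> ('a \<times> 'a) set \<Rightarrow> bool" where
  "orientation E D \<longleftrightarrow>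
     (\<forall>(u, v)\<in>D. {u, v} \<in> E) \<and>
     (\<forall>u v. {u, v} \<in> E \<longrightarrow> ((u, v) \<in> D) \<noteq> ((v, u) \<in> D))"

definition cyclically_oriented :: "('a \<times> 'a) set \<Rightarrow> 'a list \<Rightarrow> bool" where
  "cyclically_oriented D vs \<longleftrightarrow>
     (\<forall>i < length vs. (vs ! i, vs ! (Suc i mod length vs)) \<in> D) \<or>
     (\<forall>i < length vs. (vs ! (Suc i mod length vs), vs ! i) \<in> D)"

definition hole_cyclic :: "'a set set \<Rightarrow> ('a \<times> 'a) set \<Rightarrow> bool" where
  "hole_cyclic E D \<longleftrightarrow> (\<forall>vs. hole E vs \<longrightarrow> cyclically_oriented D vs)"

definition hole_cyclically_orientable :: "'a set set \<Rightarrow> bool" where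
  "hole_cyclically_orientable E \<longleftrightarrow> (\<exists>D. orientation E D \<and> hole_cyclic E D)"


section \<open>Linear-time computation\<close>

text \<open>
  Computations are run on a random access machine, programmed in a small structured language.
  The memory consists of registers and of arrays; since both are addressed by name, a program only
  uses finitely many registers and arrays, but the arrays are unbounded and are indexed by
  computed values in constant time.  The arithmetic is addition and truncated subtraction, and
  there is no multiplication.
\<close>

record state =
  reg :: "nat \<Rightarrow> nat"
  arr :: "nat \<Rightarrow> nat \<Rightarrow> nat"

datatype expr = Lit nat | Reg nat | Cell nat expr | Add expr expr | Sub expr expr

datatype test = Less expr expr | Equal expr expr

datatype com =
    Skip
  | Assign nat expr
  | Store nat expr expr
  | Seq com com
  | Cond test com com
  | While test com

primrec value_of :: "expr \<Rightarrow> state \<Rightarrow> nat" where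
  "value_of (Lit k) s = k"
| "value_of (Reg x) s = reg s x"
| "value_of (Cell a e) s = arr s a (value_of e s)"
| "value_of (Add e f) s = value_of e s + value_of f s"
| "value_of (Sub e f) s = value_of e s - value_of f s"

primrec holds :: "test \<Rightarrow> state \<Rightarrow> bool" where
  "holds (Less e f) s \<longleftrightarrow> value_of e s < value_of f s"
| "holds (Equal e f) s \<longleftrightarrow> value_of e s = value_of f s"

primrec expr_cost :: "expr \<Rightarrow> nat" where
  "expr_cost (Lit k) = 1"
| "expr_cost (Reg x) = 1"
| "expr_cost (Cell a e) = 1 + expr_cost e"
| "expr_cost (Add e f) = 1 + expr_cost e + expr_cost f"
| "expr_cost (Sub e f) = 1 + expr_cost e + expr_cost f"

primrec test_cost :: "test \<Rightarrow> nat" where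
  "test_cost (Less e f) = 1 + expr_cost e + expr_cost f"
| "test_cost (Equal e f) = 1 + expr_cost e + expr_cost f"

text \<open>
  \<open>exec w c s t s'\<close>: started in \<open>s\<close>, the program \<open>c\<close> halts in \<open>s'\<close> after exactly \<open>t\<close> unit-cost
  steps.  The machine has bounded words: a run that tries to store a number, or to write to an index,
  beyond the largest word \<open>w\<close> is stuck.  (Intermediate values inside an expression exceed the
  stored numbers by at most a constant factor that depends on the program only.)
\<close>

inductive exec :: "nat \<Rightarrow> com \<Rightarrow> state \<Rightarrow> nat \<Rightarrow> state \<Rightarrow> bool" for w :: nat where
  exec_Skip: "exec w Skip s 1 s"
| exec_Assign: "value_of e s \<le> w \<Longrightarrow>
    exec w (Assign x e) s (1 + expr_cost e) (s\<lparr>reg := (reg s)(x := value_of e s)\<rparr>)"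
| exec_Store: "value_of i s \<le> w \<Longrightarrow> value_of e s \<le> w \<Longrightarrow>
    exec w (Store a i e) s (1 + expr_cost i + expr_cost e)
      (s\<lparr>arr := (arr s)(a := (arr s a)(value_of i s := value_of e s))\<rparr>)"
| exec_Seq: "exec w c s t s' \<Longrightarrow> exec w d s' t' s'' \<Longrightarrow> exec w (Seq c d) s (t + t') s''"
| exec_CondTrue: "holds b s \<Longrightarrow> exec w c s t s' \<Longrightarrow> exec w (Cond b c d) s (test_cost b + t) s'"
| exec_CondFalse: "\<not> holds b s \<Longrightarrow> exec w d s t s' \<Longrightarrow> exec w (Cond b c d) s (test_cost b + t) s'"
| exec_WhileFalse: "\<not> holds b s \<Longrightarrow> exec w (While b c) s (test_cost b) s"
| exec_WhileTrue: "holds b s \<Longrightarrow> exec w c s t s' \<Longrightarrow> exec w (While b c) s' t' s'' \<Longrightarrow>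
    exec w (While b c) s (test_cost b + t + t') s''"

lemma exec_deterministic:
  "exec w c s t s' \<Longrightarrow> exec w c s u s'' \<Longrightarrow> u = t \<and> s'' = s'"
proof (induction arbitrary: u s'' rule: exec.induct)
  case (exec_Seq c s t s' d t' s2)
  from exec_Seq.prems show ?case
    by (cases rule: exec.cases) (use exec_Seq.IH in blast)
next
  case (exec_CondTrue b s c t s' d)
  from exec_CondTrue.prems show ?case
    by (cases rule: exec.cases) (use exec_CondTrue in blast)+
next
  case (exec_CondFalse b s d t s' c)
  from exec_CondFalse.prems show ?case
    by (cases rule: exec.cases) (use exec_CondFalse in blast)+
next
  case (exec_WhileTrue b s c t s' t' s2)
  from exec_WhileTrue.prems show ?case
    by (cases rule: exec.cases) (use exec_WhileTrue in blast)+
qed (erule exec.cases; simp)+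

text \<open>
  An input graph has the vertices \<open>0, \<dots>, n - 1\<close> and is given by adjacency lists, each of them in
  an arbitrary order.  They are stored one after another: \<open>n\<close> is in register 0, the list of \<open>v\<close>
  occupies the cells of array 1 from index \<open>p v\<close> up to, but excluding, index \<open>p (v + 1)\<close>, and
  the positions \<open>p 0, \<dots>, p n\<close> are in array 0.  All other memory is 0.
\<close>

definition adjacency_lists :: "nat \<Rightarrow> nat set set \<Rightarrow> nat list list \<Rightarrow> bool" where
  "adjacency_lists n E adj \<longleftrightarrow> length adj = n \<and>
     (\<forall>v<n. distinct (adj ! v) \<and> set (adj ! v) = nbhd {..<n} E v)"

definition initial_state :: "nat list list \<Rightarrow> state" where
  "initial_state adj =
     \<lparr>reg = (\<lambda>x. 0)(0 := length adj),
      arr = (\<lambda>a i. 0)(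
        0 := (\<lambda>v. if v \<le> length adj then length (concat (take v adj)) else 0),
        1 := (\<lambda>j. if j < length (concat adj) then concat adj ! j else 0))\<rparr>"

text \<open>The output is a list: its length is in register 0 and its entries are in array 2.\<close>

definition output_list :: "state \<Rightarrow> nat list" where
  "output_list s = map (arr s 2) [0..<reg s 0]"

text \<open>
  \<open>linear_time_computable P R\<close>: a single program computes, for every input graph that satisfies
  \<open>P\<close>, some list that is related to the graph by \<open>R\<close>, in time \<open>O(n + m)\<close> and on words of
  \<open>O(log (n + m))\<close> bits, where \<open>n\<close> and \<open>m\<close> are the numbers of vertices and edges.
\<close>

definition linear_time_computable ::
    "(nat set \<Rightarrow> nat set set \<Rightarrow> bool) \<Rightarrow> (nat set \<Rightarrow> nat set set \<Rightarrow> nat list \<Rightarrow> bool) \<Rightarrow> bool" where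
  "linear_time_computable P R \<longleftrightarrow>
     (\<exists>prog c. \<forall>n E adj.
        simple_graph {..<n} E \<and> P {..<n} E \<and> adjacency_lists n E adj \<longrightarrow>
        (\<exists>t s. exec ((n + card E + 1) ^ c) prog (initial_state adj) t s \<and>
           t \<le> c * (n + card E) \<and> R {..<n} E (output_list s)))"

end

(*
  If a and b are nonadjacent neighbours of the last vertex z of a lexicographic breadth-first search,
  then a hole passes through a, z and b: starting from a and b, one follows leftmost neighbours
  outside of N[z] in turn, and the two paths meet.  A hole-cyclic orientation thus directs exactly
  one of the edges az and bz towards z, hence the in-neighbours of z form a clique, and so do the
  out-neighbours.  Since prefixes of a search are searches of the induced subgraphs, a lexicographic
  breadth-first search produces a bisimplicial elimination ordering.  It takes linear time
  by partition refinement: the vertices are kept in an array in which each class of vertices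
  with equal labels is an interval, and the neighbours of the current vertex are swapped to the front
  of their classes.
*)
theory Submission
  imports Defs
begin

section \<open>Lexicographic breadth-first search orderings\<close>

text \<open>The two paths of the overview are not built as such. It is enough that \<open>a\<close>
  and \<open>b\<close> are joined through vertices outside the closed neighbourhood of
  \<open>z\<close>: a shortest connection of this kind closes up with \<open>z\<close> without
  chords. Only connectivity has to be proved, by induction on positions. The four-point condition is
  the interface between graph theory and program: it mentions neither labels nor classes. The first
  claim concerns an arbitrary vertex type, so there an ordering is obtained by greedy choice instead
  of by the program. The linear bound rests on never resetting memory. Class numbers are not reused,
  and a class emptied by splitting is abandoned; an entry of the child array counts only if it
  exceeds the class counter saved at the start of the round. A round thus costs a constant plus a
  constant per entry of one adjacency list. Each entry creates at most one class, which keeps class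
  numbers within the word bound.\<close>

lemma shortest_path:
  assumes "(x, y) \<in> R\<^sup>*"
  obtains xs where "xs \<noteq> []" "hd xs = x" "last xs = y" "set xs \<subseteq> insert x (Range R)"
    "distinct xs" "\<And>i j. i < j \<Longrightarrow> j < length xs \<Longrightarrow> (xs ! i, xs ! j) \<in> R \<longleftrightarrow> j = Suc i"
proof -
  \<comment> \<open>The range condition is how a caller confines the path to a chosen vertex set. A
    shortest such walk has no forward chord and no repetition, since a segment could be cut out.
    Forward pairs suffice because the application has undirected edges.\<close>
  define W where "W xs \<longleftrightarrow> xs \<noteq> [] \<and> hd xs = x \<and> last xs = y \<and> set xs \<subseteq> insert x (Range R) \<and>
    successively (\<lambda>a b. (a, b) \<in> R) xs" for xs
  from assms have "\<exists>xs. W xs"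
    unfolding W_def
  proof (induction rule: rtrancl_induct)
    case base
    show ?case by (rule exI[of _ "[x]"]) auto
  next
    case (step b c)
    then obtain xs where "xs \<noteq> []" "hd xs = x" "last xs = b" "set xs \<subseteq> insert x (Range R)"
      "successively (\<lambda>a b. (a, b) \<in> R) xs" by blast
    with step show ?case
      by (intro exI[of _ "xs @ [c]"]) (auto simp: successively_append_iff)
  qed
  then obtain xs where xs: "W xs" and min: "\<And>ys. W ys \<Longrightarrow> length xs \<le> length ys"
    using ex_has_least_nat[of W _ length] by blast
  have shortcut: "j \<le> Suc i" if "i < j" "j < length xs" "(xs ! i, xs ! j) \<in> R" for i j
  proof -
    have "W (take (Suc i) xs @ drop j xs)"
      using that xs unfolding W_def
      by (auto simp: successively_append_iff hd_append last_append hd_drop_conv_nth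
          last_conv_nth[of "take _ _"] min_def Suc_diff_Suc dest!: in_set_takeD in_set_dropD
          intro: successively_append_iff[of _ "take (Suc i) xs" "drop (Suc i) xs", THEN iffD1, THEN conjunct1]
           successively_append_iff[of _ "take j xs" "drop j xs", THEN iffD1, THEN conjunct2, THEN conjunct1])
    from min[OF this] that show ?thesis by auto
  qed
  have "distinct xs"
    unfolding distinct_conv_nth
  proof (intro allI impI notI)
    fix i j assume ij: "i < length xs" "j < length xs" "i \<noteq> j" "xs ! i = xs ! j"
    have False if "i < j" "j < length xs" "xs ! i = xs ! j" for i j
    proof -
      have s: "successively (\<lambda>a b. (a, b) \<in> R) (take i xs @ drop i xs)"
        "successively (\<lambda>a b. (a, b) \<in> R) (take j xs @ drop j xs)"
        using xs by (auto simp: W_def)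
      have "hd (take i xs @ drop j xs) = x"
        using that xs by (cases i) (auto simp: W_def hd_append hd_drop_conv_nth hd_conv_nth)
      then have "W (take i xs @ drop j xs)"
        using that xs s unfolding W_def
        by (auto simp del: append_take_drop_id simp: successively_append_iff hd_drop_conv_nth
            dest!: in_set_takeD in_set_dropD)
      from min[OF this] that show ?thesis by auto
    qed
    with ij show False by (metis linorder_neqE_nat)
  qed
  moreover have "(xs ! i, xs ! Suc i) \<in> R" if "Suc i < length xs" for i
    using xs that by (auto simp: W_def successively_conv_nth)
  ultimately show thesis
    using xs shortcut by (intro that[of xs]) (auto simp: W_def intro: le_antisym)
qed

text \<open>The four-point characterisation of the orderings produced by lexicographic breadth-first
  search.\<close>

definition lexbfs_ordering :: "'a set set \<Rightarrow> 'a list \<Rightarrow> bool" where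
  "lexbfs_ordering E vs \<longleftrightarrow> (\<forall>a b c. a < b \<longrightarrow> b < c \<longrightarrow> c < length vs \<longrightarrow>
     {vs ! a, vs ! c} \<in> E \<longrightarrow> {vs ! a, vs ! b} \<notin> E \<longrightarrow>
     (\<exists>d<a. {vs ! d, vs ! b} \<in> E \<and> {vs ! d, vs ! c} \<notin> E))"

lemma lexbfs_orderingD:
  assumes "lexbfs_ordering E vs" "a < b" "b < c" "c < length vs"
    "{vs ! a, vs ! c} \<in> E" "{vs ! a, vs ! b} \<notin> E"
  obtains d where "d < a" "{vs ! d, vs ! b} \<in> E" "{vs ! d, vs ! c} \<notin> E"
  using assms unfolding lexbfs_ordering_def by blast

text \<open>Here \<open>vs ! p\<close> is the leftmost neighbour of \<open>vs ! r\<close> outside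
  the closed neighbourhood of the last vertex, and \<open>R\<close> is adjacency outside that
  neighbourhood. If \<open>vs ! p\<close> misses \<open>vs ! q\<close>, the leftmost such neighbour
  \<open>p'\<close> of \<open>vs ! q\<close> lies left of \<open>p\<close>, and the triple
  \<open>p, q, r\<close> gives way to \<open>p', p, q\<close>: by induction \<open>p'\<close> is
  connected to a neighbour of \<open>vs ! p\<close>, hence to \<open>vs ! p\<close> itself.\<close>

lemma lexbfs_zigzag:
  assumes lb: "lexbfs_ordering E vs" and N: "Suc N = length vs"
  defines "R \<equiv> {(u, v). u \<noteq> vs ! N \<and> {u, vs ! N} \<notin> E \<and> v \<noteq> vs ! N \<and> {v, vs ! N} \<notin> E \<and> {u, v} \<in> E}"
  assumes "distinct vs"
    and "p < q" "q < r" "r < N" "{vs ! p, vs ! r} \<in> E" "{vs ! p, vs ! N} \<notin> E"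
    and least: "\<And>g. g < p \<Longrightarrow> {vs ! g, vs ! r} \<in> E \<Longrightarrow> {vs ! g, vs ! N} \<in> E"
  shows "\<exists>w. (vs ! p, w) \<in> R\<^sup>* \<and> w \<noteq> vs ! N \<and> {w, vs ! N} \<notin> E \<and> {w, vs ! q} \<in> E"
  using assms(5-)
proof (induction p arbitrary: q r rule: less_induct)
  case (less p)
  have nN: "vs ! g \<noteq> vs ! N" if "g < N" for g
    using that \<open>distinct vs\<close> N by (simp add: nth_eq_iff_index_eq)
  show ?case
  proof (cases "{vs ! p, vs ! q} \<in> E")
    case True
    with less.prems nN show ?thesis by (intro exI[of _ "vs ! p"]) auto
  next
    case False
    from lexbfs_orderingD[OF lb \<open>p < q\<close> \<open>q < r\<close> _ \<open>{vs ! p, vs ! r} \<in> E\<close> False] less.prems N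
    obtain g where g: "g < p" "{vs ! g, vs ! q} \<in> E" "{vs ! g, vs ! r} \<notin> E" by auto
    \<comment> \<open>Otherwise the four-point condition for \<open>g\<close>, \<open>r\<close> and
      the last position yields a neighbour of \<open>vs ! r\<close> that is not adjacent to the last
      vertex and lies left of \<open>p\<close>, against \<open>least\<close>.\<close>
    have gz: "{vs ! g, vs ! N} \<notin> E"
    proof
      assume "{vs ! g, vs ! N} \<in> E"
      from lexbfs_orderingD[OF lb _ \<open>r < N\<close> _ this g(3)] g less.prems N
      obtain h where "h < g" "{vs ! h, vs ! r} \<in> E" "{vs ! h, vs ! N} \<notin> E" by auto
      with less.prems(6)[of h] g show False by auto
    qed
    \<comment> \<open>Taking the leftmost candidate rather than \<open>g\<close> restores the
      minimality hypothesis for the triple \<open>p', p, q\<close>.\<close>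
    define p' where "p' = (LEAST p. {vs ! p, vs ! q} \<in> E \<and> {vs ! p, vs ! N} \<notin> E)"
    have p': "{vs ! p', vs ! q} \<in> E" "{vs ! p', vs ! N} \<notin> E"
      using LeastI[of "\<lambda>p. {vs ! p, vs ! q} \<in> E \<and> {vs ! p, vs ! N} \<notin> E" g] g gz
      unfolding p'_def by auto
    have "p' \<le> g" unfolding p'_def using g gz by (intro Least_le) auto
    have l: "{vs ! h, vs ! N} \<in> E" if "h < p'" "{vs ! h, vs ! q} \<in> E" for h
      using not_less_Least[of h "\<lambda>p. {vs ! p, vs ! q} \<in> E \<and> {vs ! p, vs ! N} \<notin> E"] that
      unfolding p'_def by auto
    from less.IH[of p' p q] obtain w where w: "(vs ! p', w) \<in> R\<^sup>*" "w \<noteq> vs ! N"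
      "{w, vs ! N} \<notin> E" "{w, vs ! p} \<in> E"
      using \<open>p' \<le> g\<close> g less.prems p' l by auto
    have "sym R" unfolding R_def sym_def by (auto simp: insert_commute)
    then have "(w, vs ! p') \<in> R\<^sup>*" using w(1) by (meson symD sym_rtrancl)
    moreover have "(vs ! p, w) \<in> R"
      using w less.prems nN[of p] by (auto simp: R_def insert_commute)
    ultimately have "(vs ! p, vs ! p') \<in> R\<^sup>*" by auto
    with p' nN[of p'] \<open>p' \<le> g\<close> g less.prems show ?thesis by (intro exI[of _ "vs ! p'"]) auto
  qed
qed

section \<open>The last vertex of a search\<close>

lemma simple_graphD:
  assumes "simple_graph V E"
  shows "{u, v} \<in> E \<Longrightarrow> u \<in> V \<and> v \<in> V \<and> u \<noteq> v"
  using assms unfolding simple_graph_def by fastforce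

text \<open>The four-point condition for \<open>a\<close>, \<open>b\<close> and the last position
  provides a neighbour of \<open>vs ! b\<close> outside the closed neighbourhood of the last vertex;
  the zigzag links the leftmost one to a neighbour of \<open>vs ! a\<close>.\<close>

lemma lexbfs_last_hole:
  assumes G: "simple_graph (set vs) E" and lb: "lexbfs_ordering E vs" and N: "Suc N = length vs"
    and d: "distinct vs" and b: "a < b" "b < N" and e: "{vs ! a, vs ! N} \<in> E" "{vs ! b, vs ! N} \<in> E"
      "{vs ! a, vs ! b} \<notin> E"
  shows "\<exists>xs. hole E (vs ! N # xs) \<and> hd xs = vs ! a \<and> last xs = vs ! b"
proof -
  define x y z where "x = vs ! a" and "y = vs ! b" and "z = vs ! N"
  define R where "R = {(u, v). u \<noteq> z \<and> {u, z} \<notin> E \<and> v \<noteq> z \<and> {v, z} \<notin> E \<and> {u, v} \<in> E}"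
  let ?P = "\<lambda>p. {vs ! p, y} \<in> E \<and> {vs ! p, z} \<notin> E"
  from lexbfs_orderingD[OF lb b(1,2) _ e(1,3)] N
  obtain c where c: "c < a" "?P c" by (auto simp: y_def z_def)
  define p where "p = (LEAST p. ?P p)"
  have p: "?P p" "p < a"
    using LeastI[of ?P, OF c(2)] Least_le[of ?P, OF c(2)] c(1) unfolding p_def by auto
  have "\<exists>w. (vs ! p, w) \<in> R\<^sup>* \<and> w \<noteq> z \<and> {w, z} \<notin> E \<and> {w, x} \<in> E"
    unfolding R_def x_def y_def z_def
    using lb N d p b not_less_Least[of _ ?P, folded p_def]
    by (intro lexbfs_zigzag[of E vs N p a b]) (auto simp: y_def z_def)
  then obtain w where w: "(vs ! p, w) \<in> R\<^sup>*" "w \<noteq> z" "{w, z} \<notin> E" "{w, x} \<in> E" by blast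
  have xyz: "x \<noteq> y" "x \<noteq> z" "y \<noteq> z" "vs ! p \<noteq> z"
    using d N b p unfolding x_def y_def z_def by (auto simp: nth_eq_iff_index_eq)
  \<comment> \<open>Within \<open>S\<close> only \<open>x\<close> and \<open>y\<close> are adjacent
    to \<open>z\<close>, so a path in \<open>S\<close> from \<open>x\<close> to \<open>y\<close>
    acquires no chord from \<open>z\<close>. It has an inner vertex because \<open>x\<close> and
    \<open>y\<close> are nonadjacent.\<close>
  define S where "S = {u. u \<noteq> z \<and> {u, z} \<notin> E} \<union> {x, y}"
  define R' where "R' = {(u, v). u \<in> S \<and> v \<in> S \<and> {u, v} \<in> E}"
  have "sym R'" by (auto simp: R'_def sym_def insert_commute)
  have "R \<subseteq> R'" by (auto simp: R_def R'_def S_def)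
  with w(1) have "(vs ! p, w) \<in> R'\<^sup>*" using rtrancl_mono by blast
  moreover have "(w, x) \<in> R'" "(y, vs ! p) \<in> R'"
    using w p xyz by (auto simp: R'_def S_def insert_commute)
  ultimately have "(y, x) \<in> R'\<^sup>*" by (meson converse_rtrancl_into_rtrancl rtrancl.rtrancl_into_rtrancl)
  with \<open>sym R'\<close> have "(x, y) \<in> R'\<^sup>*" by (meson symD sym_rtrancl)
  then obtain xs where xs: "xs \<noteq> []" "hd xs = x" "last xs = y" "set xs \<subseteq> insert x (Range R')"
    "distinct xs" and ch: "\<And>i j. i < j \<Longrightarrow> j < length xs \<Longrightarrow> (xs ! i, xs ! j) \<in> R' \<longleftrightarrow> j = Suc i"
    by (rule shortest_path) blast
  have S: "set xs \<subseteq> S" using xs(4) by (auto simp: R'_def S_def)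
  have chE: "{xs ! i, xs ! j} \<in> E \<longleftrightarrow> j = Suc i" if "i < j" "j < length xs" for i j
    using ch[OF that] S that by (auto simp: R'_def subset_iff)
  have z: "z \<notin> set xs" using S xyz by (auto simp: S_def)
  have ends: "xs ! 0 = x" "xs ! (length xs - 1) = y" using xs by (auto simp: hd_conv_nth last_conv_nth)
  have zadj: "i = 0 \<or> i = length xs - 1" if "{z, xs ! i} \<in> E" "i < length xs" for i
  proof -
    have "xs ! i = x \<or> xs ! i = y" using S that by (auto simp: S_def insert_commute dest!: nth_mem)
    with that xs(1,5) ends show ?thesis
      by (metis diff_less length_greater_0_conv nth_eq_iff_index_eq zero_less_one)
  qed
  have len: "length xs \<ge> 3"
  proof (rule ccontr)
    assume "\<not> ?thesis"
    moreover have "length xs > 0" using xs(1) by simp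
    ultimately consider "length xs = 1" | "length xs = 2" by linarith
    then show False
    proof cases
      case 1 with ends xyz show False by auto
    next
      case 2 with ends chE[of 0 1] e show False by (auto simp: x_def y_def)
    qed
  qed
  have cyc: "cycle E (z # xs)"
    unfolding cycle_def
  proof (intro conjI allI impI)
    fix i assume i: "i < length (z # xs)"
    consider "i = 0" | "i = length xs" | i' where "i = Suc i'" "i < length xs"
      using i by (cases i) (auto simp: less_Suc_eq)
    then show "{(z # xs) ! i, (z # xs) ! (Suc i mod length (z # xs))} \<in> E"
    proof cases
      case 1 with e ends len show ?thesis
        by (auto simp: x_def z_def insert_commute)
    next
      case 2 with e ends len show ?thesis
        by (auto simp: y_def z_def insert_commute nth_Cons')
    next
      case 3 with chE[of i' i] show ?thesis by (auto)
    qed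
  qed (use len xs z in auto)
  have "e \<in> cycle_edges (z # xs)" if eE: "e \<in> E" "e \<subseteq> set (z # xs)" for e
  proof -
    let ?l = "z # xs"
    obtain u v where uv: "e = {u, v}" "u \<noteq> v"
      using G \<open>e \<in> E\<close> by (auto simp: simple_graph_def card_2_iff)
    then obtain i0 j0 where "i0 < length ?l" "j0 < length ?l" "?l ! i0 = u" "?l ! j0 = v"
      using eE(2) by (metis in_set_conv_nth insert_subset)
    then have "\<exists>i j. i < j \<and> j < length ?l \<and> e = {?l ! i, ?l ! j}"
      using uv by (metis insert_commute linorder_neqE_nat)
    then obtain i j where ij: "i < j" "j < length ?l" "e = {?l ! i, ?l ! j}" by blast
    show ?thesis
    proof (cases "i = 0")
      case True
      with ij zadj[of "j - 1"] eE(1) consider "j = 1" | "j = length xs" by fastforce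
      then show ?thesis
      proof cases
        case 1 with True ij len show ?thesis
          by (auto simp: cycle_edges_def intro!: exI[of _ 0])
      next
        case 2 with True ij len show ?thesis
          by (auto simp: cycle_edges_def insert_commute intro!: exI[of _ "length xs"])
      qed
    next
      case False
      then obtain i' j' where "i = Suc i'" "j = Suc j'" using ij by (metis Suc_lessE not0_implies_Suc)
      with ij chE[of i' j'] eE(1) show ?thesis
        by (auto simp: cycle_edges_def intro!: exI[of _ i])
    qed
  qed
  then have "chordless E (z # xs)" by (auto simp: chordless_def induced_edges_def)
  with cyc len xs show ?thesis
    by (intro exI[of _ xs]) (auto simp: hole_def x_def y_def z_def)
qed

lemma lexbfs_last_bisimplicial:
  assumes G: "simple_graph (set vs) E" and hc: "hole_cyclically_orientable E"
    and lb: "lexbfs_ordering E vs" and d: "distinct vs"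
  shows "bisimplicial (set vs) E (last vs)"
proof -
  from hc obtain D where o: "orientation E D" and hc: "hole_cyclic E D"
    by (auto simp: hole_cyclically_orientable_def)
  from G have ne: "vs \<noteq> []" by (auto simp: simple_graph_def)
  then obtain N where N: "Suc N = length vs" by (metis length_greater_0_conv Suc_pred)
  define z where "z = vs ! N"
  have z: "last vs = z" using ne N by (auto simp: z_def last_conv_nth simp flip: N)
  have opp: "(z, vs ! a) \<in> D \<and> (vs ! b, z) \<in> D \<or> (vs ! a, z) \<in> D \<and> (z, vs ! b) \<in> D"
    if ab: "a < b" "b < N" "{vs ! a, z} \<in> E" "{vs ! b, z} \<in> E" "{vs ! a, vs ! b} \<notin> E" for a b
  proof -
    obtain xs where xs: "hole E (z # xs)" "hd xs = vs ! a" "last xs = vs ! b"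
      using lexbfs_last_hole[OF G lb N d ab[unfolded z_def]] unfolding z_def by blast
    have l: "length xs \<ge> 3" using xs by (simp add: hole_def)
    then have [simp]: "xs \<noteq> []" by auto
    have "(\<forall>i < length (z # xs). ((z # xs) ! i, (z # xs) ! (Suc i mod length (z # xs))) \<in> D) \<or>
        (\<forall>i < length (z # xs). ((z # xs) ! (Suc i mod length (z # xs)), (z # xs) ! i) \<in> D)"
      using hc xs(1) unfolding hole_cyclic_def cyclically_oriented_def by blast
    then show ?thesis
    proof
      assume c: "\<forall>i < length (z # xs). ((z # xs) ! i, (z # xs) ! (Suc i mod length (z # xs))) \<in> D"
      \<comment> \<open>Index 0 is the edge from \<open>z\<close> to the first vertex of
        \<open>xs\<close>; index \<open>length xs\<close> is the wrap-around edge from the last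
        vertex of \<open>xs\<close> to \<open>z\<close>.\<close>
      from c[rule_format, of 0] c[rule_format, of "length xs"] xs(2,3) show ?thesis
        by (auto simp: hd_conv_nth last_conv_nth nth_Cons')
    next
      assume c: "\<forall>i < length (z # xs). ((z # xs) ! (Suc i mod length (z # xs)), (z # xs) ! i) \<in> D"
      from c[rule_format, of 0] c[rule_format, of "length xs"] xs(2,3) show ?thesis
        by (auto simp: hd_conv_nth last_conv_nth nth_Cons')
    qed
  qed
  have anti: "\<not> ((u, v) \<in> D \<and> (v, u) \<in> D)" for u v
    using o unfolding orientation_def by blast
  have idx: "\<exists>a<N. vs ! a = u" if "{u, z} \<in> E" for u
  proof -
    have "u \<in> set vs" "u \<noteq> z" using simple_graphD[OF G that] by auto
    then show ?thesis using N unfolding z_def by (metis in_set_conv_nth less_Suc_eq)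
  qed
  have opp': "(z, u) \<in> D \<and> (v, z) \<in> D \<or> (u, z) \<in> D \<and> (z, v) \<in> D"
    if uv: "{u, z} \<in> E" "{v, z} \<in> E" "{u, v} \<notin> E" "u \<noteq> v" for u v
  proof -
    obtain a b where ab: "a < N" "b < N" "u = vs ! a" "v = vs ! b" using idx uv by metis
    with uv consider "a < b" | "b < a" by (metis linorder_neqE_nat)
    then show ?thesis
    proof cases
      case 1 with opp[of a b] ab uv show ?thesis by auto
    next
      case 2 with opp[of b a] ab uv show ?thesis by (auto simp: insert_commute)
    qed
  qed
  let ?I = "{u. {u, z} \<in> E \<and> (u, z) \<in> D}" and ?O = "{u. {u, z} \<in> E \<and> (z, u) \<in> D}"
  have "nbhd (set vs) E z = ?I \<union> ?O"
    using simple_graphD[OF G] o unfolding nbhd_def orientation_def by blast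
  moreover have "clique (set vs) E ?I" "clique (set vs) E ?O"
    unfolding clique_def using simple_graphD[OF G] opp' anti by blast+
  ultimately show ?thesis
    unfolding bisimplicial_def z using ne N by (auto simp: z_def simp flip: N)
qed

section \<open>Induced subgraphs and prefixes\<close>

lemma hole_induced_edges: "hole (induced_edges E S) vs \<Longrightarrow> hole E vs"
proof -
  assume h: "hole (induced_edges E S) vs"
  \<comment> \<open>Every vertex of the cycle lies on a cycle edge contained in \<open>S\<close>.
    Hence all edges of \<open>E\<close> between its vertices survive in the induced subgraph, and
    chordlessness there is chordlessness in \<open>E\<close>.\<close>
  have "set vs \<subseteq> S"
  proof
    fix v assume "v \<in> set vs"
    then obtain i where "i < length vs" "v = vs ! i" by (auto simp: in_set_conv_nth)
    with h show "v \<in> S" by (auto simp: hole_def cycle_def induced_edges_def)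
  qed
  with h show "hole E vs"
    by (auto simp: hole_def cycle_def chordless_def induced_edges_def subset_iff)
qed

lemma hole_cyclically_orientable_induced:
  assumes "hole_cyclically_orientable E"
  shows "hole_cyclically_orientable (induced_edges E S)"
proof -
  from assms obtain D where "orientation E D" and hc: "hole_cyclic E D"
    by (auto simp: hole_cyclically_orientable_def)
  then have o: "orientation (induced_edges E S) {(u, v) \<in> D. u \<in> S \<and> v \<in> S}"
    by (auto simp: orientation_def induced_edges_def)
  have "cyclically_oriented {(u, v) \<in> D. u \<in> S \<and> v \<in> S} vs" if h: "hole (induced_edges E S) vs" for vs
  proof -
    have "vs ! i \<in> S \<and> vs ! (Suc i mod length vs) \<in> S" if "i < length vs" for i
      using h that by (auto simp: hole_def cycle_def induced_edges_def)
    moreover have "cyclically_oriented D vs"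
      using hc hole_induced_edges[OF h] by (auto simp: hole_cyclic_def)
    ultimately show ?thesis by (auto simp: cyclically_oriented_def)
  qed
  with o show ?thesis by (auto simp: hole_cyclically_orientable_def hole_cyclic_def)
qed

text \<open>The four-point condition passes to prefixes because its witness lies to the left of the
  three given vertices, so truncation cannot remove it.\<close>

lemma lexbfs_bisimplicial_elimination_ordering:
  assumes G: "simple_graph V E" and hc: "hole_cyclically_orientable E"
    and lb: "lexbfs_ordering E vs" and d: "distinct vs" and V: "set vs = V"
  shows "bisimplicial_elimination_ordering V E vs"
  unfolding bisimplicial_elimination_ordering_def
proof (intro conjI ballI)
  fix i assume i: "i \<in> {1..length vs}"
  let ?ws = "take i vs" and ?F = "induced_edges E (set (take i vs))"
  have F: "{?ws ! a, ?ws ! b} \<in> ?F \<longleftrightarrow> {vs ! a, vs ! b} \<in> E" if "a < i" "b < i" for a b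
    using that i by (auto simp: induced_edges_def in_set_conv_nth)
  have "lexbfs_ordering ?F ?ws"
    unfolding lexbfs_ordering_def
  proof (intro allI impI)
    fix a b c assume abc: "a < b" "b < c" "c < length ?ws" "{?ws ! a, ?ws ! c} \<in> ?F" "{?ws ! a, ?ws ! b} \<notin> ?F"
    then have "{vs ! a, vs ! c} \<in> E" "{vs ! a, vs ! b} \<notin> E" using F[of a c] F[of a b] by auto
    with abc obtain d where "d < a" "{vs ! d, vs ! b} \<in> E" "{vs ! d, vs ! c} \<notin> E"
      using lexbfs_orderingD[OF lb abc(1,2)] by auto
    with abc F[of d b] F[of d c] show "\<exists>d<a. {?ws ! d, ?ws ! b} \<in> ?F \<and> {?ws ! d, ?ws ! c} \<notin> ?F" by auto
  qed
  moreover have "simple_graph (set ?ws) ?F"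
    using G i V by (auto simp: simple_graph_def induced_edges_def)
  ultimately have "bisimplicial (set ?ws) ?F (last ?ws)"
    using hole_cyclically_orientable_induced[OF hc] d by (intro lexbfs_last_bisimplicial) auto
  moreover have "last ?ws = vs ! (i - 1)" using i by (subst last_conv_nth) (auto simp: min_def)
  ultimately show "bisimplicial (set ?ws) ?F (vs ! (i - 1))" by simp
qed (use d V in auto)

text \<open>Going through the prefix, keep only the neighbours of each vertex whenever there are any.\<close>

lemma lexicographically_maximal_label:
  assumes "S \<noteq> {}"
  shows "\<exists>u\<in>S. \<forall>c\<in>S. \<forall>a<length vs. P (vs ! a) c \<longrightarrow> \<not> P (vs ! a) u \<longrightarrow>
           (\<exists>d<a. P (vs ! d) u \<and> \<not> P (vs ! d) c)"
  using assms
proof (induction vs arbitrary: S)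
  case (Cons x vs)
  define T where "T = (if \<exists>u\<in>S. P x u then {u\<in>S. P x u} else S)"
  have "T \<noteq> {}" using Cons.prems by (auto simp: T_def)
  with Cons.IH obtain u where u: "u \<in> T" and *: "\<And>c a. c \<in> T \<Longrightarrow> a < length vs \<Longrightarrow>
    P (vs ! a) c \<Longrightarrow> \<not> P (vs ! a) u \<Longrightarrow> \<exists>d<a. P (vs ! d) u \<and> \<not> P (vs ! d) c" by meson
  have "\<exists>d<a. P ((x # vs) ! d) u \<and> \<not> P ((x # vs) ! d) c"
    if c: "c \<in> S" "a < length (x # vs)" "P ((x # vs) ! a) c" "\<not> P ((x # vs) ! a) u" for c a
  proof (cases a)
    case 0
    with c u show ?thesis by (auto simp: T_def split: if_splits)
  next
    case (Suc a')
    show ?thesis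
    proof (cases "c \<in> T")
      case True
      with *[of c a'] c Suc obtain d where "d < a'" "P (vs ! d) u" "\<not> P (vs ! d) c" by auto
      with Suc show ?thesis by (intro exI[of _ "Suc d"]) auto
    next
      case False
      with u c Suc show ?thesis by (intro exI[of _ 0]) (auto simp: T_def split: if_splits)
    qed
  qed
  moreover have "u \<in> S" using u by (auto simp: T_def split: if_splits)
  ultimately show ?case by blast
qed auto

lemma lexbfs_ordering_exists:
  assumes "finite V"
  shows "\<exists>vs. distinct vs \<and> set vs = V \<and> lexbfs_ordering E vs"
proof -
  \<comment> \<open>\<open>c\<close> ranges over all vertices outside the first \<open>b\<close>,
    placed or not. The condition on the vertices already placed is therefore unaffected by later
    choices, and the next vertex only has to have a maximal label among those left.\<close>
  have "\<exists>vs. length vs = k \<and> distinct vs \<and> set vs \<subseteq> V \<and>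
     (\<forall>a b. a < b \<longrightarrow> b < k \<longrightarrow> (\<forall>c\<in>V - set (take b vs). {vs ! a, c} \<in> E \<longrightarrow> {vs ! a, vs ! b} \<notin> E \<longrightarrow>
       (\<exists>d<a. {vs ! d, vs ! b} \<in> E \<and> {vs ! d, c} \<notin> E)))" if "k \<le> card V" for k
    using that
  proof (induction k)
    case (Suc k)
    then obtain vs where vs: "length vs = k" "distinct vs" "set vs \<subseteq> V"
      and *: "\<And>a b c. a < b \<Longrightarrow> b < k \<Longrightarrow> c \<in> V - set (take b vs) \<Longrightarrow> {vs ! a, c} \<in> E \<Longrightarrow>
       {vs ! a, vs ! b} \<notin> E \<Longrightarrow> \<exists>d<a. {vs ! d, vs ! b} \<in> E \<and> {vs ! d, c} \<notin> E"
      by (metis Suc_leD)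
    have "card (set vs) < card V" using vs Suc.prems by (simp add: distinct_card)
    then have "V - set vs \<noteq> {}" using vs(3) by auto
    from lexicographically_maximal_label[OF this, of vs "\<lambda>x y. {x, y} \<in> E"]
    obtain u where u: "u \<in> V - set vs" and **: "\<And>c a. c \<in> V - set vs \<Longrightarrow> a < k \<Longrightarrow>
      {vs ! a, c} \<in> E \<Longrightarrow> {vs ! a, u} \<notin> E \<Longrightarrow> \<exists>d<a. {vs ! d, u} \<in> E \<and> {vs ! d, c} \<notin> E"
      using vs(1) by blast
    have "\<exists>d<a. {(vs @ [u]) ! d, (vs @ [u]) ! b} \<in> E \<and> {(vs @ [u]) ! d, c} \<notin> E"
      if "a < b" "b < Suc k" "c \<in> V - set (take b (vs @ [u]))" "{(vs @ [u]) ! a, c} \<in> E"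
        "{(vs @ [u]) ! a, (vs @ [u]) ! b} \<notin> E" for a b c
    proof (cases "b = k")
      case True
      with **[of c a] that vs(1) obtain d where "d < a" "{vs ! d, u} \<in> E" "{vs ! d, c} \<notin> E"
        by (auto simp: nth_append)
      with True that vs(1) show ?thesis by (intro exI[of _ d]) (auto simp: nth_append)
    next
      case False
      with *[of a b c] that vs(1) obtain d where "d < a" "{vs ! d, vs ! b} \<in> E" "{vs ! d, c} \<notin> E"
        by (auto simp: nth_append)
      with False that vs(1) show ?thesis by (intro exI[of _ d]) (auto simp: nth_append)
    qed
    with vs u show ?case by (intro exI[of _ "vs @ [u]"]) auto
  qed auto
  from this[of "card V"] obtain vs where vs: "length vs = card V" "distinct vs" "set vs \<subseteq> V"
     and *: "\<And>a b c. a < b \<Longrightarrow> b < card V \<Longrightarrow> c \<in> V - set (take b vs) \<Longrightarrow> {vs ! a, c} \<in> E \<Longrightarrow>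
       {vs ! a, vs ! b} \<notin> E \<Longrightarrow> \<exists>d<a. {vs ! d, vs ! b} \<in> E \<and> {vs ! d, c} \<notin> E"
    by auto
  have "set vs = V" using vs assms by (simp add: card_subset_eq distinct_card)
  moreover have "vs ! c \<notin> set (take b vs)" if "b < c" "c < length vs" for b c
    using that \<open>distinct vs\<close> by (auto simp: in_set_conv_nth nth_eq_iff_index_eq)
  ultimately show ?thesis
    using vs * unfolding lexbfs_ordering_def
    by (intro exI[of _ vs]) (auto simp: subset_iff)
qed

section \<open>Partition refinement\<close>

definition inverse_arrays :: "nat \<Rightarrow> (nat \<Rightarrow> nat) \<Rightarrow> (nat \<Rightarrow> nat) \<Rightarrow> bool" where
  "inverse_arrays n ord pos \<longleftrightarrow>
     (\<forall>x<n. ord x < n \<and> pos (ord x) = x) \<and> (\<forall>u<n. pos u < n \<and> ord (pos u) = u)"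

text \<open>The vertices at the positions \<open>i, \<dots>, n - 1\<close> are partitioned into classes that occupy
  consecutive positions; \<open>start k\<close> is the first position of class \<open>k\<close>.\<close>

definition classes :: "nat \<Rightarrow> nat \<Rightarrow> (nat \<Rightarrow> nat) \<Rightarrow> (nat \<Rightarrow> nat) \<Rightarrow> (nat \<Rightarrow> nat) \<Rightarrow> nat \<Rightarrow> bool" where
  "classes n i ord cls start cnt \<longleftrightarrow>
     (\<forall>y. i \<le> y \<longrightarrow> y < n \<longrightarrow> cls (ord y) \<le> cnt \<and> i \<le> start (cls (ord y)) \<and>
        start (cls (ord y)) \<le> y \<and>
        (\<forall>x. start (cls (ord y)) \<le> x \<longrightarrow> x \<le> y \<longrightarrow> cls (ord x) = cls (ord y)))"

text \<open>The label of a vertex, its set of neighbours among the first \<open>i\<close>, is never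
  stored, only compared through \<open>P\<close>. The second clause is weaker than lexicographic
  comparison, but it is what the third clause demands of vertices in different classes once position
  \<open>i\<close> joins the prefix. For \<open>i = n\<close> the third clause becomes the
  four-point condition.\<close>

definition labels :: "(nat \<Rightarrow> nat \<Rightarrow> bool) \<Rightarrow> nat \<Rightarrow> nat \<Rightarrow> (nat \<Rightarrow> nat) \<Rightarrow> (nat \<Rightarrow> nat) \<Rightarrow> bool" where
  "labels P n i ord cls \<longleftrightarrow>
     (\<forall>y z. i \<le> y \<longrightarrow> y < n \<longrightarrow> i \<le> z \<longrightarrow> z < n \<longrightarrow> cls (ord y) = cls (ord z) \<longrightarrow>
        (\<forall>d<i. P (ord d) (ord y) = P (ord d) (ord z))) \<and>
     (\<forall>y z. i \<le> y \<longrightarrow> y < z \<longrightarrow> z < n \<longrightarrow> cls (ord y) \<noteq> cls (ord z) \<longrightarrow>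
        (\<exists>d<i. P (ord d) (ord y) \<and> \<not> P (ord d) (ord z))) \<and>
     (\<forall>a b c. a < i \<longrightarrow> a < b \<longrightarrow> b < c \<longrightarrow> c < n \<longrightarrow> P (ord a) (ord c) \<longrightarrow> \<not> P (ord a) (ord b) \<longrightarrow>
        (\<exists>d<a. P (ord d) (ord b) \<and> \<not> P (ord d) (ord c)))"

text \<open>The state while the classes \<open>0, \<dots>, base\<close> given by \<open>ord0\<close>, \<open>cls0\<close> and \<open>start0\<close> are being
  split by the neighbours of the vertex at position \<open>i\<close>, of which those in \<open>F\<close> have been treated.
  They have been moved to the front of their class \<open>k\<close> and form the new class \<open>child k\<close>.\<close>

definition splitting :: "nat \<Rightarrow> nat \<Rightarrow> (nat \<Rightarrow> nat) \<Rightarrow> (nat \<Rightarrow> nat) \<Rightarrow> (nat \<Rightarrow> nat) \<Rightarrow> nat \<Rightarrow> nat set \<Rightarrow>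
    (nat \<Rightarrow> nat) \<Rightarrow> (nat \<Rightarrow> nat) \<Rightarrow> (nat \<Rightarrow> nat) \<Rightarrow> (nat \<Rightarrow> nat) \<Rightarrow> (nat \<Rightarrow> nat) \<Rightarrow> nat \<Rightarrow> bool" where
  "splitting n i ord0 cls0 start0 base F ord pos cls start child cnt \<longleftrightarrow>
     base \<le> cnt \<and> (\<forall>k. child k \<le> cnt) \<and>
     (\<forall>k l. base < child k \<longrightarrow> child k = child l \<longrightarrow> k = l) \<and>
     inverse_arrays n ord pos \<and> (\<forall>x\<le>i. ord x = ord0 x \<and> ord x \<notin> F) \<and>
     (\<forall>y. i < y \<longrightarrow> y < n \<longrightarrow> cls0 (ord y) = cls0 (ord0 y) \<and>
        (ord y \<in> F \<longleftrightarrow> y < start (cls0 (ord0 y))) \<and>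
        start0 (cls0 (ord0 y)) \<le> start (cls0 (ord0 y)) \<and>
        (child (cls0 (ord0 y)) \<le> base \<longrightarrow> start (cls0 (ord0 y)) = start0 (cls0 (ord0 y))) \<and>
        (base < child (cls0 (ord0 y)) \<longrightarrow> start (child (cls0 (ord0 y))) = start0 (cls0 (ord0 y))) \<and>
        cls (ord y) = (if ord y \<in> F then child (cls0 (ord0 y)) else cls0 (ord0 y)))"

text \<open>The class of the vertex at position \<open>i\<close> must start there, and every other
  class starts later because classes are intervals. If the class becomes empty, its start is stale,
  but no remaining vertex refers to it.\<close>

lemma classes_remove_first:
  assumes "classes n i ord cls start cnt" "i < n"
  shows "classes n (Suc i) ord cls (start(cls (ord i) := Suc i)) cnt"
proof -
  have C: "cls (ord y) \<le> cnt" "i \<le> start (cls (ord y))" "start (cls (ord y)) \<le> y"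
    "\<And>x. start (cls (ord y)) \<le> x \<Longrightarrow> x \<le> y \<Longrightarrow> cls (ord x) = cls (ord y)" if "i \<le> y" "y < n" for y
    using assms(1) that unfolding classes_def by blast+
  have st0: "start (cls (ord i)) = i" using C(2,3)[of i] assms by auto
  have lt: "Suc i \<le> start (cls (ord y))" if "i \<le> y" "y < n" "cls (ord y) \<noteq> cls (ord i)" for y
    using C(2)[of y] C(3)[of y] C(4)[of y i] that by fastforce
  define st where "st = start(cls (ord i) := Suc i)"
  have "cls (ord y) \<le> cnt \<and> Suc i \<le> st (cls (ord y)) \<and> st (cls (ord y)) \<le> y \<and>
      (\<forall>x. st (cls (ord y)) \<le> x \<longrightarrow> x \<le> y \<longrightarrow> cls (ord x) = cls (ord y))"
    if "Suc i \<le> y" "y < n" for y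
  proof -
    have "Suc i \<le> st (cls (ord y)) \<and> st (cls (ord y)) \<le> y \<and> start (cls (ord y)) \<le> st (cls (ord y))"
      using lt[of y] C(3)[of y] that st0 unfolding st_def by (cases "cls (ord y) = cls (ord i)") auto
    with C(1,4)[of y] that show ?thesis by (meson Suc_leD le_trans)
  qed
  then show ?thesis
    unfolding classes_def st_def by blast
qed

text \<open>With the current counter as \<open>base\<close>, every entry left over in
  \<open>child\<close> is at most \<open>base\<close> and so reads as "not yet split". This is why
  \<open>child\<close> need not be cleared between rounds.\<close>

lemma splitting_init:
  assumes "inverse_arrays n ord pos" "classes n (Suc i) ord cls start cnt" "\<forall>k. child k \<le> cnt"
  shows "splitting n i ord cls start cnt {} ord pos cls start child cnt"
proof -
  have "cls (ord y) \<le> cnt \<and> start (cls (ord y)) \<le> y" if "i < y" "y < n" for y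
    using assms(2) that unfolding classes_def Suc_le_eq by blast
  with assms(1,3) show ?thesis
    unfolding splitting_def by (auto simp: leD)
qed



lemma splitting_classes:
  assumes S: "splitting n i ord0 cls0 start0 base F ord pos cls start child cnt"
    and C: "classes n (Suc i) ord0 cls0 start0 base"
  shows "classes n (Suc i) ord cls start cnt"
  unfolding classes_def
proof (intro allI impI)
  fix y assume y: "Suc i \<le> y" "y < n"
  define k where "k = cls0 (ord0 y)"
  have C: "k \<le> base" "Suc i \<le> start0 k" "start0 k \<le> y"
    "\<And>x. start0 k \<le> x \<Longrightarrow> x \<le> y \<Longrightarrow> cls0 (ord0 x) = k"
    using C y unfolding classes_def k_def by blast+
  have cnt: "base \<le> cnt" "child k \<le> cnt" using S unfolding splitting_def by auto
  have S: "(ord x \<in> F \<longleftrightarrow> x < start k) \<and> start0 k \<le> start k \<and>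
      (child k \<le> base \<longrightarrow> start k = start0 k) \<and> (base < child k \<longrightarrow> start (child k) = start0 k) \<and>
      cls (ord x) = (if ord x \<in> F then child k else k)" if "start0 k \<le> x" "x \<le> y" for x
    using S that C(2) C(4)[of x] y unfolding splitting_def by auto
  \<comment> \<open>A treated vertex lies before \<open>start k\<close> but not before
    \<open>start0 k\<close>, so the start has moved, which happens only after a child was
    created.\<close>
  have "child k > base" if "ord y \<in> F"
    using S[of y] C(3) that by force
  with S C cnt show "cls (ord y) \<le> cnt \<and> Suc i \<le> start (cls (ord y)) \<and> start (cls (ord y)) \<le> y \<and>
    (\<forall>x. start (cls (ord y)) \<le> x \<longrightarrow> x \<le> y \<longrightarrow> cls (ord x) = cls (ord y))"
    using S[of y] by auto
qed

text \<open>The vertex \<open>u\<close> is exchanged with the first untreated member of its class,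
  and the boundary between treated and untreated members moves up by one. Both lie in the same old
  class, so the old intervals are respected; the exchange is trivial if they coincide.\<close>

lemma splitting_step:
  assumes S: "splitting n i ord0 cls0 start0 base F ord pos cls start child cnt"
    and C: "classes n (Suc i) ord0 cls0 start0 base"
    and u: "u < n" "i < pos u" "u \<notin> F"
    and s: "s = start (cls u)"
    and new: "if base < child (cls u) then child' = child \<and> start' = start \<and> cnt' = cnt
       else cnt' = Suc cnt \<and> child' = child(cls u := cnt') \<and> start' = start(cnt' := s)"
  shows "s < n" "ord s < n"
    "splitting n i ord0 cls0 start0 base (insert u F) (ord(s := u, pos u := ord s)) (pos(u := s, ord s := pos u))
       (cls(u := child' (cls u))) (start'(cls u := Suc s)) child' cnt'"
proof -
  define y where "y = pos u"
  define w where "w = ord s"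
  define k where "k = cls0 (ord0 y)"
  have inv: "\<And>x. x < n \<Longrightarrow> ord x < n \<and> pos (ord x) = x" "\<And>u. u < n \<Longrightarrow> pos u < n \<and> ord (pos u) = u"
    using S unfolding splitting_def inverse_arrays_def by auto
  have y: "i < y" "y < n" "ord y = u" using u inv unfolding y_def by auto
  have C': "cls0 (ord0 z) \<le> base" "Suc i \<le> start0 (cls0 (ord0 z))" "start0 (cls0 (ord0 z)) \<le> z"
    "\<And>x. start0 (cls0 (ord0 z)) \<le> x \<Longrightarrow> x \<le> z \<Longrightarrow> cls0 (ord0 x) = cls0 (ord0 z)"
    if "i < z" "z < n" for z
    using C that unfolding classes_def Suc_le_eq by blast+
  have S': "cls0 (ord z) = cls0 (ord0 z)"
        "ord z \<in> F \<longleftrightarrow> z < start (cls0 (ord0 z))"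
        "start0 (cls0 (ord0 z)) \<le> start (cls0 (ord0 z))"
        "child (cls0 (ord0 z)) \<le> base \<Longrightarrow> start (cls0 (ord0 z)) = start0 (cls0 (ord0 z))"
        "base < child (cls0 (ord0 z)) \<Longrightarrow> start (child (cls0 (ord0 z))) = start0 (cls0 (ord0 z))"
        "cls (ord z) = (if ord z \<in> F then child (cls0 (ord0 z)) else cls0 (ord0 z))"
    if "i < z" "z < n" for z
    using S that unfolding splitting_def by blast+
  have cnt: "base \<le> cnt" "\<And>k. child k \<le> cnt" "\<And>k l. base < child k \<Longrightarrow> child k = child l \<Longrightarrow> k = l"
    and pre: "\<And>x. x \<le> i \<Longrightarrow> ord x = ord0 x \<and> ord x \<notin> F"
    using S unfolding splitting_def by blast+
  \<comment> \<open>Since \<open>u\<close> is untreated, its current class is still its old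
    one.\<close>
  have cu: "cls u = k" using S'(6)[of y] y u(3) k_def by auto
  have sy: "s \<le> y" "start0 k \<le> s" using S'(2,3)[of y] y u(3) s cu unfolding k_def by auto
  have i_s: "i < s" using C'(2)[of y] y sy k_def by auto
  show sn: "s < n" using sy y by auto
  then show "ord s < n" using inv by auto
  have ks: "cls0 (ord0 s) = k" using C'(4)[of y s] y sy k_def by auto
  have wF: "w \<notin> F" using S'(2)[of s] i_s sn ks s cu unfolding w_def by auto
  have w: "pos w = s" "w < n" using inv sn unfolding w_def by auto
  have kb: "k \<le> base" using C'(1)[of y] y k_def by auto
  define ord' pos' cls' start'' where "ord' = ord(s := u, y := w)" and "pos' = pos(u := s, w := y)"
    and "cls' = cls(u := child' k)" and "start'' = start'(k := Suc s)"
  have inv': "inverse_arrays n ord' pos'"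
    unfolding inverse_arrays_def
  proof (intro conjI allI impI)
    fix x assume x: "x < n"
    have "ord x \<noteq> u \<and> ord x \<noteq> w" if "x \<noteq> s" "x \<noteq> y"
      using inv(1)[OF x] w(1) that y_def by auto
    then show "ord' x < n" "pos' (ord' x) = x"
      using inv(1)[OF x] w(1,2) u(1) unfolding ord'_def pos'_def by (auto simp: y_def)
  next
    fix x assume x: "x < n"
    have "pos x \<noteq> s \<and> pos x \<noteq> y" if "x \<noteq> u" "x \<noteq> w"
      using inv(2)[OF x] y(3) that w_def by auto
    then show "pos' x < n" "ord' (pos' x) = x"
      using inv(2)[OF x] sn y(2,3) w_def unfolding ord'_def pos'_def by auto
  qed
  have cnt': "base \<le> cnt'" "\<And>k. child' k \<le> cnt'" "base < child' k"
    and inj': "\<And>k l. base < child' k \<Longrightarrow> child' k = child' l \<Longrightarrow> k = l"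
  proof -
    have "\<forall>l. child l < Suc cnt" using cnt(2) by (auto simp: less_Suc_eq_le)
    then have *: "child l \<noteq> Suc cnt" "Suc cnt \<noteq> child l" "child l \<le> Suc cnt" for l
      by (metis less_irrefl less_imp_le)+
    show "base \<le> cnt'" "\<And>k. child' k \<le> cnt'" "base < child' k"
      using new cnt(1,2) cu * by (auto split: if_splits)
    show "k = l" if "base < child' k" "child' k = child' l" for k l
      using new cnt(3)[of k l] cu * that by (auto split: if_splits)
  qed
  have st: "start'' l = start l" if "l \<le> base" "l \<noteq> k" for l
    using new that cnt cu unfolding start''_def by (auto split: if_splits)
  have ch: "child' l = child l" if "l \<noteq> k" for l
    using new that cu by (auto split: if_splits)
  have stc: "start'' (child' l) = start (child l)" if "l \<noteq> k" "base < child l" for l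
    using new that cnt(2)[of l] cnt(1) cu kb unfolding start''_def by (auto split: if_splits)
  have stk: "start'' (child' k) = start0 k"
    using new cu cnt S'(4,5)[of y] y kb s unfolding start''_def k_def by (auto split: if_splits)
  have O: "cls0 (ord' z) = cls0 (ord0 z)" if "i < z" "z < n" for z
    using S'(1) that y ks sn i_s unfolding ord'_def w_def k_def by auto
  have main: "(ord' z \<in> insert u F \<longleftrightarrow> z < start'' (cls0 (ord0 z))) \<and>
        start0 (cls0 (ord0 z)) \<le> start'' (cls0 (ord0 z)) \<and>
        (child' (cls0 (ord0 z)) \<le> base \<longrightarrow> start'' (cls0 (ord0 z)) = start0 (cls0 (ord0 z))) \<and>
        (base < child' (cls0 (ord0 z)) \<longrightarrow> start'' (child' (cls0 (ord0 z))) = start0 (cls0 (ord0 z))) \<and>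
        cls' (ord' z) = (if ord' z \<in> insert u F then child' (cls0 (ord0 z)) else cls0 (ord0 z))"
    if z: "i < z" "z < n" for z
  proof (cases "cls0 (ord0 z) = k")
    case False
    then have "z \<noteq> s" "z \<noteq> y" using ks k_def by auto
    moreover have "ord z \<noteq> u" using \<open>z \<noteq> y\<close> inv z y by metis
    ultimately show ?thesis
      using S'[OF z] st[OF C'(1)[OF z] False] ch[OF False] stc[OF False]
      by (auto simp: ord'_def cls'_def)
  next
    case True
    consider "z = s" | "z = y" "z \<noteq> s" | "z \<noteq> s" "z \<noteq> y" by auto
    then have "(ord' z \<in> insert u F \<longleftrightarrow> z < Suc s) \<and> cls' (ord' z) = (if ord' z \<in> insert u F then child' k else k)"
    proof cases
      case 1
      have "ord' z = u" using 1 by (auto simp: ord'_def w_def y)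
      then show ?thesis using 1 by (auto simp: cls'_def)
    next
      case 2
      have "w \<noteq> u" using 2 w y_def by auto
      with 2 wF sy S'(6)[of s] i_s sn ks show ?thesis by (auto simp: ord'_def cls'_def w_def)
    next
      case 3
      moreover have "ord z \<noteq> u" using 3 inv z y by metis
      \<comment> \<open>A treated member of class \<open>k\<close> shows that the class was already
        split in this round, so its child is not reassigned.\<close>
      moreover have "child' k = child k" if "ord z \<in> F"
        using S'(2,4)[OF z] C'(3)[OF z] that True new cu by (auto split: if_splits)
      ultimately show ?thesis using S'(2,6)[OF z] True s cu by (auto simp: ord'_def cls'_def)
    qed
    moreover have "start'' k = Suc s" by (simp add: start''_def)
    ultimately show ?thesis using True stk cnt' sy by auto
  qed
  have pre': "ord' x = ord0 x \<and> ord' x \<notin> insert u F" if "x \<le> i" for x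
  proof -
    have "x \<noteq> s" "x \<noteq> y" "x < n" using that i_s y by auto
    moreover from this have "ord x \<noteq> u" using inv(1)[of x] y_def by auto
    ultimately show ?thesis using pre[OF that] by (auto simp: ord'_def)
  qed
  have "splitting n i ord0 cls0 start0 base (insert u F) ord' pos' cls' start'' child' cnt'"
    unfolding splitting_def using cnt' inj' inv' main O pre' by blast
  then show "splitting n i ord0 cls0 start0 base (insert u F) (ord(s := u, pos u := ord s)) (pos(u := s, ord s := pos u))
       (cls(u := child' (cls u))) (start'(cls u := Suc s)) child' cnt'"
    unfolding cu y_def[symmetric] w_def[symmetric] ord'_def pos'_def cls'_def start''_def .
qed

text \<open>Vertices of one old class are separated by adjacency to the vertex at position
  \<open>i\<close>, the neighbours having moved to the front; vertices of different old classes keep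
  their earlier witness.\<close>

lemma splitting_labels:
  assumes S: "splitting n i ord0 cls0 start0 base F ord pos cls start child cnt"
    and C: "classes n (Suc i) ord0 cls0 start0 base"
    and L: "labels P n i ord0 cls0" and inv0: "inverse_arrays n ord0 pos0"
    and F: "\<And>y. i < y \<Longrightarrow> y < n \<Longrightarrow> ord y \<in> F \<longleftrightarrow> P (ord0 i) (ord y)"
  shows "labels P n (Suc i) ord cls"
proof -
  have C': "cls0 (ord0 z) \<le> base" "start0 (cls0 (ord0 z)) \<le> z" if "i < z" "z < n" for z
    using C that unfolding classes_def Suc_le_eq by blast+
  have S': "cls0 (ord z) = cls0 (ord0 z)"
        "ord z \<in> F \<longleftrightarrow> z < start (cls0 (ord0 z))"
        "child (cls0 (ord0 z)) \<le> base \<Longrightarrow> start (cls0 (ord0 z)) = start0 (cls0 (ord0 z))"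
        "cls (ord z) = (if ord z \<in> F then child (cls0 (ord0 z)) else cls0 (ord0 z))"
    if "i < z" "z < n" for z
    using S that unfolding splitting_def by blast+
  have inj: "\<And>k l. base < child k \<Longrightarrow> child k = child l \<Longrightarrow> k = l"
    and pre: "\<And>x. x \<le> i \<Longrightarrow> ord x = ord0 x" and inv: "inverse_arrays n ord pos"
    using S unfolding splitting_def by blast+
  have L1: "P (ord0 d) (ord0 y) = P (ord0 d) (ord0 z)"
    if "i \<le> y" "y < n" "i \<le> z" "z < n" "cls0 (ord0 y) = cls0 (ord0 z)" "d < i" for d y z
    using L that unfolding labels_def by blast
  have L2: "\<exists>d<i. P (ord0 d) (ord0 y) \<and> \<not> P (ord0 d) (ord0 z)"
    if "i \<le> y" "y < z" "z < n" "cls0 (ord0 y) \<noteq> cls0 (ord0 z)" for y z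
    using L that unfolding labels_def by blast
  have L3: "\<exists>d<a. P (ord0 d) (ord0 b) \<and> \<not> P (ord0 d) (ord0 c)"
    if "a < i" "a < b" "b < c" "c < n" "P (ord0 a) (ord0 c)" "\<not> P (ord0 a) (ord0 b)" for a b c
    using L that unfolding labels_def by blast
  \<comment> \<open>Vertices are permuted only within old classes, whose members have the same
    neighbours among the first \<open>i\<close>. So the adjacencies seen at a position do not
    change.\<close>
  have rows: "P (ord d) (ord y) = P (ord0 d) (ord0 y)" if "d < i" "y < n" for d y
  proof (cases "y \<le> i")
    case True
    with pre that show ?thesis by auto
  next
    case False
    define z where "z = pos0 (ord y)"
    have z: "z < n" "ord0 z = ord y"
      using inv inv0 that unfolding inverse_arrays_def z_def by auto
    have "\<not> z \<le> i"
    proof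
      assume "z \<le> i"
      then have "ord z = ord y" using pre z by auto
      then have "z = y" using inv z that unfolding inverse_arrays_def by metis
      with False \<open>z \<le> i\<close> show False by auto
    qed
    then show ?thesis using L1[of z y d] z False that S'(1)[of y] pre[of d] by auto
  qed
  have same: "cls0 (ord0 y) = cls0 (ord0 z) \<and> (ord y \<in> F \<longleftrightarrow> ord z \<in> F)"
    if "i < y" "y < n" "i < z" "z < n" "cls (ord y) = cls (ord z)" for y z
  proof -
    \<comment> \<open>The class number of a treated vertex exceeds \<open>base\<close>, so it
      differs from all old numbers; injectivity of \<open>child\<close> above \<open>base\<close>
      then recovers the old class.\<close>
    have "base < child (cls0 (ord0 x))" if "i < x" "x < n" "ord x \<in> F" for x
      using S'(2,3)[of x] C'(2)[of x] that by fastforce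
    with that S'(4)[of y] S'(4)[of z] C'(1)[of y] C'(1)[of z] inj show ?thesis
      by (metis not_le)
  qed
  have sep: "P (ord i) (ord y) \<and> \<not> P (ord i) (ord z) \<or> (\<exists>d<i. P (ord d) (ord y) \<and> \<not> P (ord d) (ord z))"
    if "i < y" "y < z" "z < n" "cls0 (ord0 y) \<noteq> cls0 (ord0 z) \<or> (ord y \<in> F) \<noteq> (ord z \<in> F)" for y z
  proof (cases "cls0 (ord0 y) = cls0 (ord0 z)")
    case True
    with that S'(2)[of y] S'(2)[of z] F[of y] F[of z] pre[of i] show ?thesis by auto
  next
    case False
    with L2[of y z] that rows[of _ y] rows[of _ z] show ?thesis by (metis less_imp_le less_trans)
  qed
  show ?thesis
    unfolding labels_def
  proof (intro conjI allI impI)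
    fix y z d assume "Suc i \<le> y" "y < n" "Suc i \<le> z" "z < n" "cls (ord y) = cls (ord z)" "d < Suc i"
    with same[of y z] L1[of y z d] rows[of d] F[of y] F[of z] pre[of i]
    show "P (ord d) (ord y) = P (ord d) (ord z)" by (auto simp: less_Suc_eq)
  next
    fix y z assume yz: "Suc i \<le> y" "y < z" "z < n" "cls (ord y) \<noteq> cls (ord z)"
    then have "cls0 (ord0 y) \<noteq> cls0 (ord0 z) \<or> (ord y \<in> F) \<noteq> (ord z \<in> F)"
      using S'(4)[of y] S'(4)[of z] by (auto split: if_splits)
    with sep[of y z] yz
    show "\<exists>d<Suc i. P (ord d) (ord y) \<and> \<not> P (ord d) (ord z)"
      by (metis Suc_le_lessD lessI less_SucI)
  next
    fix a b c assume abc: "a < Suc i" "a < b" "b < c" "c < n" "P (ord a) (ord c)" "\<not> P (ord a) (ord b)"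
    show "\<exists>d<a. P (ord d) (ord b) \<and> \<not> P (ord d) (ord c)"
    proof (cases "a = i")
      case False
      then have "a < i" using abc by auto
      with L3[of a b c] abc rows[of _ b] rows[of _ c] show ?thesis
        by (smt (verit) order.strict_trans)
    next
      case True
      with abc sep[of b c] F[of b] F[of c] pre[of i] show ?thesis by auto
    qed
  qed
qed

section \<open>The program\<close>

text \<open>Weakest preconditions in which the postcondition also receives the unused part of the time
  budget, so that an invariant can store time for later.\<close>

definition runs :: "nat \<Rightarrow> com \<Rightarrow> state \<Rightarrow> nat \<Rightarrow> (state \<Rightarrow> nat \<Rightarrow> bool) \<Rightarrow> bool" where
  "runs w c s T Q \<longleftrightarrow> (\<exists>t s'. exec w c s t s' \<and> t \<le> T \<and> Q s' (T - t))"

lemma runs_Skip: "1 \<le> T \<Longrightarrow> Q s (T - 1) \<Longrightarrow> runs w Skip s T Q"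
  unfolding runs_def by (blast intro: exec_Skip)

lemma runs_Assign:
  "value_of e s \<le> w \<Longrightarrow> 1 + expr_cost e \<le> T \<Longrightarrow>
     Q (s\<lparr>reg := (reg s)(x := value_of e s)\<rparr>) (T - (1 + expr_cost e)) \<Longrightarrow> runs w (Assign x e) s T Q"
  unfolding runs_def by (blast intro: exec_Assign)

lemma runs_Store:
  "value_of i s \<le> w \<Longrightarrow> value_of e s \<le> w \<Longrightarrow> 1 + expr_cost i + expr_cost e \<le> T \<Longrightarrow>
     Q (s\<lparr>arr := (arr s)(a := (arr s a)(value_of i s := value_of e s))\<rparr>)
       (T - (1 + expr_cost i + expr_cost e)) \<Longrightarrow> runs w (Store a i e) s T Q"
  unfolding runs_def by (blast intro: exec_Store)

text \<open>For symbolic execution on an explicit record: the value is left open as \<open>v\<close>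
  and gets fixed by simplification, in terms of the names introduced for intermediate
  values.\<close>

lemma runs_Assign_record:
  "value_of e \<lparr>reg = r, arr = a\<rparr> = v \<Longrightarrow> v \<le> w \<Longrightarrow> 1 + expr_cost e \<le> T \<Longrightarrow>
     Q \<lparr>reg = r(x := v), arr = a\<rparr> (T - (1 + expr_cost e)) \<Longrightarrow>
     runs w (Assign x e) \<lparr>reg = r, arr = a\<rparr> T Q"
  using runs_Assign[of e "\<lparr>reg = r, arr = a\<rparr>" w T Q x] by simp

lemma runs_Store_record:
  "value_of i \<lparr>reg = r, arr = a\<rparr> = j \<Longrightarrow> value_of e \<lparr>reg = r, arr = a\<rparr> = v \<Longrightarrow> a x = f \<Longrightarrow>
     j \<le> w \<Longrightarrow> v \<le> w \<Longrightarrow> 1 + expr_cost i + expr_cost e \<le> T \<Longrightarrow>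
     Q \<lparr>reg = r, arr = a(x := f(j := v))\<rparr> (T - (1 + expr_cost i + expr_cost e)) \<Longrightarrow>
     runs w (Store x i e) \<lparr>reg = r, arr = a\<rparr> T Q"
  using runs_Store[of i "\<lparr>reg = r, arr = a\<rparr>" w e T Q x] by simp

lemma runs_Seq:
  assumes "runs w c s T (\<lambda>s' T'. runs w d s' T' Q)"
  shows "runs w (Seq c d) s T Q"
proof -
  from assms obtain t s' t' s'' where "exec w c s t s'" "t \<le> T" "exec w d s' t' s''" "t' \<le> T - t"
    "Q s'' (T - t - t')"
    unfolding runs_def by blast
  then show ?thesis
    unfolding runs_def by (intro exI[of _ "t + t'"] exI[of _ s'']) (auto intro: exec_Seq)
qed

lemma runs_Cond:
  assumes "test_cost b \<le> T" "holds b s \<Longrightarrow> runs w c s (T - test_cost b) Q"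
    "\<not> holds b s \<Longrightarrow> runs w d s (T - test_cost b) Q"
  shows "runs w (Cond b c d) s T Q"
proof -
  from assms(2,3) obtain t s' where "t \<le> T - test_cost b" "Q s' (T - test_cost b - t)"
    "exec w (Cond b c d) s (test_cost b + t) s'"
    unfolding runs_def by (cases "holds b s") (blast intro: exec_CondTrue exec_CondFalse)+
  then show ?thesis
    unfolding runs_def using assms(1)
    by (intro exI[of _ "test_cost b + t"] exI[of _ s']) auto
qed

lemma runs_CondTrue:
  "holds b s \<Longrightarrow> test_cost b \<le> T \<Longrightarrow> runs w c s (T - test_cost b) Q \<Longrightarrow> runs w (Cond b c d) s T Q"
  and runs_CondFalse:
  "\<not> holds b s \<Longrightarrow> test_cost b \<le> T \<Longrightarrow> runs w d s (T - test_cost b) Q \<Longrightarrow> runs w (Cond b c d) s T Q"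
  by (rule runs_Cond; simp)+

text \<open>Every iteration uses up time, so the time budget also guarantees termination.\<close>

lemma runs_While:
  assumes "I s T"
    and step: "\<And>s T. I s T \<Longrightarrow> holds b s \<Longrightarrow> test_cost b \<le> T \<and> runs w c s (T - test_cost b) I"
    and exit: "\<And>s T. I s T \<Longrightarrow> \<not> holds b s \<Longrightarrow> test_cost b \<le> T \<and> Q s (T - test_cost b)"
  shows "runs w (While b c) s T Q"
  using \<open>I s T\<close>
proof (induction T arbitrary: s rule: less_induct)
  case (less T)
  have pos: "0 < test_cost b" by (cases b) auto
  show ?case
  proof (cases "holds b s")
    case True
    with step[OF less.prems] obtain t s' where t: "test_cost b \<le> T" "exec w c s t s'"
      "t \<le> T - test_cost b" "I s' (T - test_cost b - t)"
      unfolding runs_def by blast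
    from less.IH[OF _ t(4)] t pos obtain t' s'' where "exec w (While b c) s' t' s''"
      "t' \<le> T - test_cost b - t" "Q s'' (T - test_cost b - t - t')"
      unfolding runs_def by auto
    with t True show ?thesis
      unfolding runs_def
      by (intro exI[of _ "test_cost b + t + t'"] exI[of _ s'']) (auto intro: exec_WhileTrue)
  next
    case False
    with exit[OF less.prems] show ?thesis
      unfolding runs_def by (blast intro: exec_WhileFalse)
  qed
qed

abbreviation (input) seq_com :: "com \<Rightarrow> com \<Rightarrow> com" (infixr ";;" 60) where
  "c ;; d \<equiv> Seq c d"

text \<open>Otherwise register 1 would become register \<open>Suc 0\<close>.\<close>

declare One_nat_def [simp del]

text \<open>Arrays 2 to 6 hold \<open>ord\<close>, \<open>pos\<close>, \<open>cls\<close>, \<open>start\<close> and \<open>child\<close>; register 1 is the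
  position of the current vertex, registers 2 and 3 delimit its unread neighbours, and registers 5
  and 6 are \<open>cnt\<close> and \<open>base\<close>.\<close>

definition lexbfs_init :: com where
  "lexbfs_init = While (Less (Reg 1) (Reg 0))
     (Store 2 (Reg 1) (Reg 1) ;;
      Store 3 (Reg 1) (Reg 1) ;;
      Assign 1 (Add (Reg 1) (Lit 1)))"

text \<open>Register 4 holds the neighbour, 7 its class, 8 the first untreated position of that
  class, 9 the vertex found there and 10 the old position of the neighbour. Both are read before the
  exchange overwrites them.\<close>

definition lexbfs_move :: com where
  "lexbfs_move =
     (Assign 7 (Cell 4 (Reg 4)) ;;
      Assign 8 (Cell 5 (Reg 7)) ;;
      Cond (Less (Reg 6) (Cell 6 (Reg 7))) Skip
        (Assign 5 (Add (Reg 5) (Lit 1)) ;;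
         Store 6 (Reg 7) (Reg 5) ;;
         Store 5 (Reg 5) (Reg 8)) ;;
      Assign 9 (Cell 2 (Reg 8)) ;;
      Assign 10 (Cell 3 (Reg 4)) ;;
      Store 2 (Reg 8) (Reg 4) ;;
      Store 2 (Reg 10) (Reg 9) ;;
      Store 3 (Reg 4) (Reg 8) ;;
      Store 3 (Reg 9) (Reg 10) ;;
      Store 5 (Reg 7) (Add (Reg 8) (Lit 1)) ;;
      Store 4 (Reg 4) (Cell 6 (Reg 7)))"

definition lexbfs_refine :: com where
  "lexbfs_refine = While (Less (Reg 2) (Reg 3))
     (Assign 4 (Cell 1 (Reg 2)) ;;
      Cond (Less (Reg 1) (Cell 3 (Reg 4))) lexbfs_move Skip ;;
      Assign 2 (Add (Reg 2) (Lit 1)))"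

text \<open>Copying the counter into register 6 makes all entries of array 6 stale at once, at
  constant cost.\<close>

definition lexbfs_main :: com where
  "lexbfs_main = While (Less (Reg 1) (Reg 0))
     (Assign 4 (Cell 2 (Reg 1)) ;;
      Store 5 (Cell 4 (Reg 4)) (Add (Reg 1) (Lit 1)) ;;
      Assign 6 (Reg 5) ;;
      Assign 2 (Cell 0 (Reg 4)) ;;
      Assign 3 (Cell 0 (Add (Reg 4) (Lit 1))) ;;
      lexbfs_refine ;;
      Assign 1 (Add (Reg 1) (Lit 1)))"

definition lexbfs_program :: com where
  "lexbfs_program = (lexbfs_init ;; Assign 1 (Lit 0) ;; lexbfs_main)"

section \<open>Correctness and cost of the program\<close>

lemma runs_init:
  assumes n: "reg s 0 = n" "reg s 1 = 0" "n \<le> w" and T: "20 * n + 10 \<le> T"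
    and Q: "\<And>s' T'. reg s' = (reg s)(1 := n) \<Longrightarrow>
       arr s' = (arr s)(2 := (\<lambda>x. if x < n then x else arr s 2 x), 3 := (\<lambda>x. if x < n then x else arr s 3 x)) \<Longrightarrow>
       T \<le> T' + 20 * n + 10 \<Longrightarrow> Q s' T'"
  shows "runs w lexbfs_init s T Q"
proof -
  \<comment> \<open>An iteration takes 13 steps, which 20 rounds up; the extra 10 covers the final
    test.\<close>
  define I where "I s' T' \<longleftrightarrow> (\<exists>i\<le>n. reg s' = (reg s)(1 := i) \<and>
       arr s' = (arr s)(2 := (\<lambda>x. if x < i then x else arr s 2 x), 3 := (\<lambda>x. if x < i then x else arr s 3 x)) \<and>
       T \<le> T' + 20 * i)" for s' :: state and T'
  show ?thesis
    unfolding lexbfs_init_def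
  proof (rule runs_While[where I = I])
    show "I s T"
      unfolding I_def by (rule exI[of _ 0]) (auto simp: fun_eq_iff n)
  next
    fix s' T' assume "I s' T'" and h: "holds (Less (Reg 1) (Reg 0)) s'"
    then obtain i where i: "i \<le> n" "reg s' = (reg s)(1 := i)" "T \<le> T' + 20 * i"
      "arr s' = (arr s)(2 := (\<lambda>x. if x < i then x else arr s 2 x), 3 := (\<lambda>x. if x < i then x else arr s 3 x))"
      unfolding I_def by blast
    have "i < n" using h i n by simp
    then have I': "I s'' T''" if "reg s'' = (reg s)(1 := Suc i)" "T \<le> T'' + 20 * Suc i"
      "arr s'' = (arr s)(2 := (\<lambda>x. if x < Suc i then x else arr s 2 x), 3 := (\<lambda>x. if x < Suc i then x else arr s 3 x))"
      for s'' T''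
      using that unfolding I_def by (intro exI[of _ "Suc i"]) auto
    have "runs w (Store 2 (Reg 1) (Reg 1) ;; Store 3 (Reg 1) (Reg 1) ;; Assign 1 (Add (Reg 1) (Lit 1)))
        s' (T' - 3) I"
      using i n T \<open>i < n\<close>
      by (intro runs_Seq runs_Store runs_Assign I') (auto simp: fun_eq_iff less_Suc_eq)
    then show "test_cost (Less (Reg 1) (Reg 0)) \<le> T' \<and>
      runs w (Store 2 (Reg 1) (Reg 1) ;; Store 3 (Reg 1) (Reg 1) ;; Assign 1 (Add (Reg 1) (Lit 1)))
        s' (T' - test_cost (Less (Reg 1) (Reg 0))) I"
      using i T \<open>i < n\<close> by simp
  next
    fix s' T' assume "I s' T'" and h: "\<not> holds (Less (Reg 1) (Reg 0)) s'"
    then obtain i where i: "i \<le> n" "reg s' = (reg s)(1 := i)" "T \<le> T' + 20 * i"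
      "arr s' = (arr s)(2 := (\<lambda>x. if x < i then x else arr s 2 x), 3 := (\<lambda>x. if x < i then x else arr s 3 x))"
      unfolding I_def by blast
    with h n have "i = n" by simp
    with i T show "test_cost (Less (Reg 1) (Reg 0)) \<le> T' \<and> Q s' (T' - test_cost (Less (Reg 1) (Reg 0)))"
      by (auto intro: Q)
  qed
qed

text \<open>The code is executed once for each outcome of the test for an existing child. It takes
  at most 47 steps, which 60 rounds up.\<close>

lemma runs_move:
  assumes S: "splitting n i ord0 cls0 start0 base F (arr s 2) (arr s 3) (arr s 4) (arr s 5) (arr s 6) (reg s 5)"
    and C: "classes n (Suc i) ord0 cls0 start0 base"
    and u: "reg s 4 < n" "i < arr s 3 (reg s 4)" "reg s 4 \<notin> F"
    and b: "reg s 6 = base" and w: "n \<le> w" "Suc (reg s 5) \<le> w" and T: "60 \<le> T"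
    and Q: "\<And>s' T'. splitting n i ord0 cls0 start0 base (insert (reg s 4) F) (arr s' 2) (arr s' 3)
       (arr s' 4) (arr s' 5) (arr s' 6) (reg s' 5) \<Longrightarrow> arr s' 0 = arr s 0 \<Longrightarrow> arr s' 1 = arr s 1 \<Longrightarrow>
       \<forall>x\<in>{0,1,2,3,6}. reg s' x = reg s x \<Longrightarrow> reg s' 5 \<le> Suc (reg s 5) \<Longrightarrow> T \<le> T' + 60 \<Longrightarrow> Q s' T'"
  shows "runs w lexbfs_move s T Q"
proof -
  obtain r a where sra: "s = \<lparr>reg = r, arr = a\<rparr>" by (cases s)
  define u0 k s0 w0 q where "u0 = r 4" and "k = a 4 u0" and "s0 = a 5 k" and "w0 = a 2 s0" and "q = a 3 u0"
  note S = S[unfolded sra, simplified] and u = u[unfolded sra, simplified, folded u0_def]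
    and Q = Q[unfolded sra, simplified, folded u0_def]
  have inv: "inverse_arrays n (a 2) (a 3)" and ch: "a 6 k \<le> r 5"
    using S unfolding splitting_def by blast+
  then have u0: "q < n" "a 2 (a 3 u0) = u0"
    using u(1) unfolding inverse_arrays_def q_def by auto
  \<comment> \<open>This bounds the class number \<open>k\<close>, which must fit into a word to be
    copied to register 7 and used as an index.\<close>
  have "classes n (Suc i) (a 2) (a 4) (a 5) (r 5)" using splitting_classes[OF S C] .
  then have "a 4 (a 2 (a 3 u0)) \<le> r 5"
    using u0 u(2) unfolding classes_def Suc_le_eq q_def by blast
  then have k: "k \<le> r 5" using u0 unfolding k_def by simp
  note step = splitting_step[OF S C u, folded k_def, OF s0_def, folded w0_def q_def]
  have b: "r 6 = base" and w: "n \<le> w" "r 5 < w" using b w sra by auto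
  note defs = u0_def[symmetric] k_def[symmetric] s0_def[symmetric] w0_def[symmetric] q_def[symmetric]
  show ?thesis
  proof (cases "base < a 6 k")
    case True
    note st = step[of "a 6" "a 5" "r 5"]
    have n: "s0 < n" "w0 < n" "splitting n i ord0 cls0 start0 base (insert u0 F)
         ((a 2)(s0 := u0, q := w0)) ((a 3)(u0 := s0, w0 := q)) ((a 4)(u0 := a 6 k)) ((a 5)(k := Suc s0)) (a 6) (r 5)"
      using st True by auto
    show ?thesis
      unfolding lexbfs_move_def sra
      using b w n(1,2) u u0 k T ch True defs
      apply -
      apply (rule runs_Seq | (rule runs_Assign_record runs_Store_record runs_CondTrue runs_Skip, (simp; fail)+))+
      apply (rule Q)
      using n(3) by (simp_all add: Suc_eq_plus1)
  next
    case False
    note st = step[of "(a 6)(k := Suc (r 5))" "(a 5)(Suc (r 5) := s0)" "Suc (r 5)"]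
    have n: "s0 < n" "w0 < n" "splitting n i ord0 cls0 start0 base (insert u0 F)
         ((a 2)(s0 := u0, q := w0)) ((a 3)(u0 := s0, w0 := q)) ((a 4)(u0 := Suc (r 5)))
         ((a 5)(Suc (r 5) := s0, k := Suc s0)) ((a 6)(k := Suc (r 5))) (Suc (r 5))"
      using st False by auto
    show ?thesis
      unfolding lexbfs_move_def sra
      using b w n(1,2) u u0 k T ch False defs
      apply -
      apply (rule runs_Seq | (rule runs_Assign_record runs_Store_record runs_CondFalse, (simp; fail)+))+
      apply (rule Q)
      using n(3) by (simp_all add: Suc_eq_plus1)
  qed
qed


lemma runs_refine:
  fixes pos0 :: "nat \<Rightarrow> nat"
  assumes S: "splitting n i ord0 cls0 start0 base {} (arr s 2) (arr s 3) (arr s 4) (arr s 5) (arr s 6) (reg s 5)"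
    and C: "classes n (Suc i) ord0 cls0 start0 base" and inv0: "inverse_arrays n ord0 pos0"
    and regs: "reg s 1 = i" "reg s 2 = p" "reg s 3 = p + length l" "reg s 6 = base"
    and l: "distinct l" "\<And>x. x < length l \<Longrightarrow> arr s 1 (p + x) = l ! x" "set l \<subseteq> {..<n}"
    and w: "n \<le> w" "reg s 5 + length l \<le> w" "p + length l \<le> w" and T: "80 * length l + 10 \<le> T"
    and Q: "\<And>s' T'. splitting n i ord0 cls0 start0 base {u \<in> set l. i < pos0 u} (arr s' 2) (arr s' 3)
       (arr s' 4) (arr s' 5) (arr s' 6) (reg s' 5) \<Longrightarrow> arr s' 0 = arr s 0 \<Longrightarrow> arr s' 1 = arr s 1 \<Longrightarrow>
       reg s' 0 = reg s 0 \<Longrightarrow> reg s' 1 = i \<Longrightarrow>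
       reg s' 5 \<le> reg s 5 + length l \<Longrightarrow> T \<le> T' + 80 * length l + 10 \<Longrightarrow> Q s' T'"
  shows "runs w lexbfs_refine s T Q"
proof -
  define I where "I s' T' \<longleftrightarrow> (\<exists>x\<le>length l.
      splitting n i ord0 cls0 start0 base {u \<in> set (take x l). i < pos0 u} (arr s' 2) (arr s' 3)
       (arr s' 4) (arr s' 5) (arr s' 6) (reg s' 5) \<and> arr s' 0 = arr s 0 \<and> arr s' 1 = arr s 1 \<and>
       reg s' 0 = reg s 0 \<and> reg s' 1 = i \<and> reg s' 2 = p + x \<and> reg s' 3 = p + length l \<and>
       reg s' 6 = base \<and> reg s' 5 \<le> reg s 5 + x \<and> T \<le> T' + 80 * x)" for s' :: state and T'
  \<comment> \<open>The program tests current positions, while the treated set is described by the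
    positions at the start of the round. The tests agree because positions up to \<open>i\<close>
    are never touched.\<close>
  have pos: "i < pos u \<longleftrightarrow> i < pos0 u"
    if S: "splitting n i ord0 cls0 start0 base F ord pos cls start child cnt" and "u < n"
    for F ord pos cls start child cnt u
  proof -
    have "inverse_arrays n ord pos" "\<forall>x\<le>i. ord x = ord0 x" using S unfolding splitting_def by blast+
    with inv0 \<open>u < n\<close> show ?thesis unfolding inverse_arrays_def by (metis not_le)
  qed
  show ?thesis
    unfolding lexbfs_refine_def
  proof (rule runs_While[where I = I])
    show "I s T" unfolding I_def using S regs by (intro exI[of _ 0]) auto
  next
    fix s' T' assume "I s' T'" and h: "holds (Less (Reg 2) (Reg 3)) s'"
    then obtain x where x: "x \<le> length l" and S: "splitting n i ord0 cls0 start0 base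
        {u \<in> set (take x l). i < pos0 u} (arr s' 2) (arr s' 3)
       (arr s' 4) (arr s' 5) (arr s' 6) (reg s' 5)" and a: "arr s' 0 = arr s 0" "arr s' 1 = arr s 1"
      and r: "reg s' 0 = reg s 0" "reg s' 1 = i" "reg s' 2 = p + x" "reg s' 3 = p + length l"
       "reg s' 6 = base" and r5: "reg s' 5 \<le> reg s 5 + x" and T': "T \<le> T' + 80 * x"
      unfolding I_def by blast
    have xl: "x < length l" using h r by simp
    define u where "u = l ! x"
    have u: "u < n" "arr s' 1 (p + x) = u" "u \<notin> set (take x l)"
      using l xl a by (auto simp: u_def set_conv_nth nth_eq_iff_index_eq)
    have tk: "set (take (Suc x) l) = insert u (set (take x l))"
      using xl by (simp add: take_Suc_conv_app_nth u_def)
    have T80: "80 \<le> T'" using T T' xl by simp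
    let ?s = "s'\<lparr>reg := (reg s')(4 := u)\<rparr>"
    \<comment> \<open>Loop test, load, position test and move take at most 3 + 3 + 4 + 60 steps. The
      allowance of 75 leaves room for the closing assignment of 4 steps within 80 per
      neighbour.\<close>
    have fin: "runs w (Assign 2 (Add (Reg 2) (Lit 1))) s'' T'' I"
      if "splitting n i ord0 cls0 start0 base {u \<in> set (take (Suc x) l). i < pos0 u} (arr s'' 2) (arr s'' 3)
       (arr s'' 4) (arr s'' 5) (arr s'' 6) (reg s'' 5)" "arr s'' 0 = arr s 0" "arr s'' 1 = arr s 1"
       "\<forall>x\<in>{0,1,2,3,6}. reg s'' x = reg s' x" "reg s'' 5 \<le> Suc (reg s' 5)" "T' \<le> T'' + 75" for s'' T''
      using that x r r5 T' T80 xl w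
      by (intro runs_Assign; simp add: I_def Suc_eq_plus1)
    have "runs w (Cond (Less (Reg 1) (Cell 3 (Reg 4))) lexbfs_move Skip) ?s (T' - 6)
        (\<lambda>s' T'. runs w (Assign 2 (Add (Reg 2) (Lit 1))) s' T' I)"
    proof (rule runs_Cond)
      show "test_cost (Less (Reg 1) (Cell 3 (Reg 4))) \<le> T' - 6" using T80 by simp
    next
      assume "holds (Less (Reg 1) (Cell 3 (Reg 4))) ?s"
      then have i: "i < arr s' 3 u" using r by simp
      then have "{u \<in> set (take (Suc x) l). i < pos0 u} = insert u {u \<in> set (take x l). i < pos0 u}"
        using pos[OF S u(1)] tk by auto
      then show "runs w lexbfs_move ?s (T' - 6 - test_cost (Less (Reg 1) (Cell 3 (Reg 4))))
        (\<lambda>s' T'. runs w (Assign 2 (Add (Reg 2) (Lit 1))) s' T' I)"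
        using S i u r r5 w xl T80 a
        by (intro runs_move[where F = "{u \<in> set (take x l). i < pos0 u}", OF _ C]) (auto intro!: fin)
    next
      assume "\<not> holds (Less (Reg 1) (Cell 3 (Reg 4))) ?s"
      then have "\<not> i < arr s' 3 u" using r by simp
      then have "{u \<in> set (take (Suc x) l). i < pos0 u} = {u \<in> set (take x l). i < pos0 u}"
        using pos[OF S u(1)] tk by auto
      then show "runs w Skip ?s (T' - 6 - test_cost (Less (Reg 1) (Cell 3 (Reg 4))))
        (\<lambda>s' T'. runs w (Assign 2 (Add (Reg 2) (Lit 1))) s' T' I)"
        using S T80 a by (intro runs_Skip fin) auto
    qed
    then have "runs w (Assign 4 (Cell 1 (Reg 2)) ;;
      Cond (Less (Reg 1) (Cell 3 (Reg 4))) lexbfs_move Skip ;;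
      Assign 2 (Add (Reg 2) (Lit 1))) s' (T' - 3) I"
      using u(1,2) w T80 r by (intro runs_Seq runs_Assign) auto
    then show "test_cost (Less (Reg 2) (Reg 3)) \<le> T' \<and> runs w (Assign 4 (Cell 1 (Reg 2)) ;;
      Cond (Less (Reg 1) (Cell 3 (Reg 4))) lexbfs_move Skip ;;
      Assign 2 (Add (Reg 2) (Lit 1))) s' (T' - test_cost (Less (Reg 2) (Reg 3))) I"
      using T80 by simp
  next
    fix s' T' assume "I s' T'" and h: "\<not> holds (Less (Reg 2) (Reg 3)) s'"
    then obtain x where "x \<le> length l" and S: "splitting n i ord0 cls0 start0 base
        {u \<in> set (take x l). i < pos0 u} (arr s' 2) (arr s' 3)
       (arr s' 4) (arr s' 5) (arr s' 6) (reg s' 5)" and r: "arr s' 0 = arr s 0" "arr s' 1 = arr s 1"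
      "reg s' 0 = reg s 0" "reg s' 1 = i" "reg s' 2 = p + x" "reg s' 3 = p + length l"
       "reg s' 5 \<le> reg s 5 + x" and T': "T \<le> T' + 80 * x"
      unfolding I_def by blast
    with h have "x = length l" by simp
    with S r T T' show "test_cost (Less (Reg 2) (Reg 3)) \<le> T' \<and> Q s' (T' - test_cost (Less (Reg 2) (Reg 3)))"
      by (auto intro!: Q)
  qed
qed

section \<open>Adjacency lists and the amortised count\<close>

lemma length_concat_take_Suc:
  "v < length xss \<Longrightarrow> length (concat (take (Suc v) xss)) = length (concat (take v xss)) + length (xss ! v)"
  by (simp add: take_Suc_conv_app_nth)

lemma concat_nth_take:
  assumes "v < length xss" "x < length (xss ! v)"
  shows "length (concat (take v xss)) + x < length (concat xss)"
    "concat xss ! (length (concat (take v xss)) + x) = xss ! v ! x"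
proof -
  have "concat xss = concat (take v xss) @ xss ! v @ concat (drop (Suc v) xss)"
    using assms(1) by (metis concat.simps(2) concat_append id_take_nth_drop)
  with assms(2) show "length (concat (take v xss)) + x < length (concat xss)"
    "concat xss ! (length (concat (take v xss)) + x) = xss ! v ! x"
    by (simp_all add: nth_append)
qed

lemma length_concat_take_le: "length (concat (take v xss)) \<le> length (concat xss)"
  by (metis append_take_drop_id concat_append length_append le_add1)

text \<open>The potential of the main loop: each adjacency entry read pays for its own processing
  and for at most one new class. An edge between two processed vertices counts twice.\<close>

definition handled_edges :: "nat list list \<Rightarrow> nat \<Rightarrow> (nat \<Rightarrow> nat) \<Rightarrow> nat" where
  "handled_edges adj i ord = (\<Sum>y<i. length (adj ! ord y))"

lemma handled_edges_le:
  assumes "inverse_arrays (length adj) ord pos" "i \<le> length adj"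
  shows "handled_edges adj i ord \<le> length (concat adj)"
proof -
  have inj: "inj_on ord {..<i}"
    using assms unfolding inverse_arrays_def by (intro inj_onI) (metis lessThan_iff order.strict_trans2)
  have "handled_edges adj i ord = (\<Sum>v\<in>ord ` {..<i}. length (adj ! v))"
    unfolding handled_edges_def by (simp add: sum.reindex[OF inj])
  also have "\<dots> \<le> (\<Sum>v<length adj. length (adj ! v))"
    using assms unfolding inverse_arrays_def by (intro sum_mono2) auto
  also have "\<dots> = length (concat adj)"
    by (simp add: length_concat sum_list_sum_nth atLeast0LessThan)
  finally show ?thesis .
qed

lemma runs_main:
  fixes adj :: "nat list list" and P :: "nat \<Rightarrow> nat \<Rightarrow> bool"
  defines "n \<equiv> length adj"
  assumes adj: "\<And>v. v < n \<Longrightarrow> distinct (adj ! v) \<and> set (adj ! v) = {u \<in> {..<n}. P v u}"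
    and a0: "\<And>v. v \<le> n \<Longrightarrow> arr s 0 v = length (concat (take v adj))"
    and a1: "\<And>j. j < length (concat adj) \<Longrightarrow> arr s 1 j = concat adj ! j"
    and regs: "reg s 0 = n" "reg s 1 = 0" "reg s 5 = 0"
    and arrs: "inverse_arrays n (arr s 2) (arr s 3)" "\<And>v. arr s 4 v = 0" "\<And>k. arr s 5 k = 0" "\<And>k. arr s 6 k = 0"
    and w: "n + length (concat adj) \<le> w" and T: "80 * n + 80 * length (concat adj) + 10 \<le> T"
    and Q: "\<And>s' T'. reg s' 0 = n \<Longrightarrow> inverse_arrays n (arr s' 2) (arr s' 3) \<Longrightarrow>
       labels P n n (arr s' 2) (arr s' 4) \<Longrightarrow> Q s' T'"
  shows "runs w lexbfs_main s T Q"
proof -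
  let ?m = "length (concat adj)"
  \<comment> \<open>The last two conjuncts use the potential twice: to keep class numbers within the
    word bound, and to charge 80 steps to every vertex and every adjacency entry.\<close>
  define I where "I s' T' \<longleftrightarrow> (\<exists>i\<le>n. reg s' 0 = n \<and> reg s' 1 = i \<and> arr s' 0 = arr s 0 \<and> arr s' 1 = arr s 1 \<and>
      inverse_arrays n (arr s' 2) (arr s' 3) \<and> classes n i (arr s' 2) (arr s' 4) (arr s' 5) (reg s' 5) \<and>
      labels P n i (arr s' 2) (arr s' 4) \<and> (\<forall>k. arr s' 6 k \<le> reg s' 5) \<and>
      reg s' 5 \<le> handled_edges adj i (arr s' 2) \<and>
      80 * n + 80 * ?m + 10 \<le> T' + 80 * i + 80 * handled_edges adj i (arr s' 2))" for s' :: state and T'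
  show ?thesis
    unfolding lexbfs_main_def
  proof (rule runs_While[where I = I])
    \<comment> \<open>The zeros in arrays 4 to 6 and in register 5 already describe the trivial
      partition: one class, number 0, starting at position 0, without a child.\<close>
    show "I s T"
      unfolding I_def using regs arrs T
      by (intro exI[of _ 0]) (auto simp: classes_def labels_def handled_edges_def)
  next
    fix s' T' assume "I s' T'" and h: "holds (Less (Reg 1) (Reg 0)) s'"
    then obtain i where r: "reg s' 0 = n" "reg s' 1 = i" and a: "arr s' 0 = arr s 0" "arr s' 1 = arr s 1"
      and inv: "inverse_arrays n (arr s' 2) (arr s' 3)"
      and C: "classes n i (arr s' 2) (arr s' 4) (arr s' 5) (reg s' 5)"
      and L: "labels P n i (arr s' 2) (arr s' 4)" and ch: "\<forall>k. arr s' 6 k \<le> reg s' 5"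
      and r5: "reg s' 5 \<le> handled_edges adj i (arr s' 2)"
      and T': "80 * n + 80 * ?m + 10 \<le> T' + 80 * i + 80 * handled_edges adj i (arr s' 2)"
      unfolding I_def by blast
    define v l p start where "v = arr s' 2 i" and "l = adj ! v" and "p = arr s 0 v"
      and "start = (arr s' 5)(arr s' 4 v := Suc i)"
    have i: "i < n" using h r by simp
    have v: "v < n" using inv i unfolding inverse_arrays_def v_def by auto
    have p: "p = length (concat (take v adj))" "arr s 0 (Suc v) = p + length l"
      using a0[of v] a0[of "Suc v"] v by (auto simp: p_def l_def length_concat_take_Suc n_def)
    have H: "handled_edges adj (Suc i) (arr s' 2) = handled_edges adj i (arr s' 2) + length l"
      by (simp add: handled_edges_def l_def v_def)
    have Hle: "handled_edges adj i (arr s' 2) + length l \<le> ?m"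
      using handled_edges_le[of adj "arr s' 2" "arr s' 3" "Suc i"] inv i H by (simp add: n_def)
    have pw: "p + length l \<le> ?m"
      using length_concat_take_le[of "Suc v" adj] v p by (simp add: length_concat_take_Suc n_def l_def)
    have cls: "arr s' 4 v \<le> reg s' 5"
      using C i unfolding classes_def v_def by blast
    have C': "classes n (Suc i) (arr s' 2) (arr s' 4) start (reg s' 5)"
      using classes_remove_first[OF C i] unfolding start_def v_def .
    have T80: "80 + 80 * length l + 10 \<le> T'" using T' Hle i by simp
    let ?s = "\<lparr>reg = (reg s')(4 := v, 6 := reg s' 5, 2 := p, 3 := p + length l), arr = (arr s')(5 := start)\<rparr>"
    \<comment> \<open>Loop test and setup take 22 steps. The 40 allowed here, 10 for leaving the
      inner loop and 4 for the increment stay below the 80 charged to the vertex.\<close>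
    have refine: "runs w lexbfs_refine ?s T'' (\<lambda>s' T'. runs w (Assign 1 (Add (Reg 1) (Lit 1))) s' T' I)"
      if T'': "T' \<le> T'' + 40" for T''
    proof (rule runs_refine[where l = l and p = p and i = i, OF _ C' inv])
      show "splitting n i (arr s' 2) (arr s' 4) start (reg s' 5) {} (arr ?s 2) (arr ?s 3)
         (arr ?s 4) (arr ?s 5) (arr ?s 6) (reg ?s 5)"
        using splitting_init[OF inv C' ch] by simp
      show "distinct l" "set l \<subseteq> {..<n}" using adj[OF v] by (auto simp: l_def)
      show "arr ?s 1 (p + x) = l ! x" if "x < length l" for x
        using concat_nth_take[of v adj x] v that a a1 p by (simp add: n_def l_def)
    next
      fix s'' :: state and T3
      assume S: "splitting n i (arr s' 2) (arr s' 4) start (reg s' 5) {u \<in> set l. i < arr s' 3 u} (arr s'' 2)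
         (arr s'' 3) (arr s'' 4) (arr s'' 5) (arr s'' 6) (reg s'' 5)"
        and s'': "arr s'' 0 = arr ?s 0" "arr s'' 1 = arr ?s 1" "reg s'' 0 = reg ?s 0" "reg s'' 1 = i"
          "reg s'' 5 \<le> reg ?s 5 + length l" "T'' \<le> T3 + 80 * length l + 10"
      have inv': "inverse_arrays n (arr s'' 2) (arr s'' 3)" and ch': "\<forall>k. arr s'' 6 k \<le> reg s'' 5"
        and pre: "\<forall>x\<le>i. arr s'' 2 x = arr s' 2 x"
        using S unfolding splitting_def by blast+
      have "arr s'' 2 y \<in> {u \<in> set l. i < arr s' 3 u} \<longleftrightarrow> P (arr s' 2 i) (arr s'' 2 y)" if "i < y" "y < n" for y
      proof -
        have "i < arr s' 3 (arr s'' 2 y)"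
          using inv inv' pre that unfolding inverse_arrays_def by (metis not_le)
        then show ?thesis
          using adj[OF v] inv' that unfolding inverse_arrays_def l_def v_def by auto
      qed
      with splitting_labels[OF S C' L inv] have "labels P n (Suc i) (arr s'' 2) (arr s'' 4)" by simp
      moreover have "handled_edges adj (Suc i) (arr s'' 2) = handled_edges adj i (arr s' 2) + length l"
        using pre unfolding H[symmetric] unfolding handled_edges_def by (intro sum.cong) auto
      ultimately show "runs w (Assign 1 (Add (Reg 1) (Lit 1))) s'' T3 I"
        using splitting_classes[OF S C'] inv' ch' s'' i r a r5 T' T'' T80 w
        by (intro runs_Assign; simp add: I_def Suc_eq_plus1)
    qed (use r w r5 Hle pw T80 T'' in auto)
    obtain rr aa where s': "s' = \<lparr>reg = rr, arr = aa\<rparr>" by (cases s')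
    have "runs w (Assign 4 (Cell 2 (Reg 1)) ;;
      Store 5 (Cell 4 (Reg 4)) (Add (Reg 1) (Lit 1)) ;;
      Assign 6 (Reg 5) ;;
      Assign 2 (Cell 0 (Reg 4)) ;;
      Assign 3 (Cell 0 (Add (Reg 4) (Lit 1))) ;;
      lexbfs_refine ;;
      Assign 1 (Add (Reg 1) (Lit 1))) s' (T' - 3) I"
      using r v cls w r5 Hle pw T80 i p(2)[unfolded Suc_eq_plus1] a p_def[symmetric] v_def[symmetric]
      unfolding s'
      apply -
      apply (rule runs_Seq | (rule runs_Assign_record runs_Store_record, (simp; fail)+))+
      using refine
      unfolding start_def s' Suc_eq_plus1
      by simp
    then show "test_cost (Less (Reg 1) (Reg 0)) \<le> T' \<and>
      runs w (Assign 4 (Cell 2 (Reg 1)) ;;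
      Store 5 (Cell 4 (Reg 4)) (Add (Reg 1) (Lit 1)) ;;
      Assign 6 (Reg 5) ;;
      Assign 2 (Cell 0 (Reg 4)) ;;
      Assign 3 (Cell 0 (Add (Reg 4) (Lit 1))) ;;
      lexbfs_refine ;;
      Assign 1 (Add (Reg 1) (Lit 1))) s' (T' - test_cost (Less (Reg 1) (Reg 0))) I"
      using T80 by simp
  next
    fix s' T' assume "I s' T'" and h: "\<not> holds (Less (Reg 1) (Reg 0)) s'"
    then obtain i where "i \<le> n" "reg s' 0 = n" "reg s' 1 = i"
      and inv: "inverse_arrays n (arr s' 2) (arr s' 3)" and L: "labels P n i (arr s' 2) (arr s' 4)"
      and T': "80 * n + 80 * ?m + 10 \<le> T' + 80 * i + 80 * handled_edges adj i (arr s' 2)"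
      unfolding I_def by blast
    moreover from this h have "i = n" by simp
    moreover have "handled_edges adj n (arr s' 2) \<le> ?m"
      using handled_edges_le[of adj "arr s' 2" "arr s' 3" n] inv by (simp add: n_def)
    ultimately show "test_cost (Less (Reg 1) (Reg 0)) \<le> T' \<and> Q s' (T' - test_cost (Less (Reg 1) (Reg 0)))"
      by (auto intro!: Q)
  qed
qed

text \<open>Double counting of incidences; in the time bound it turns the total length of the
  adjacency lists into \<open>2 * card E\<close>.\<close>

lemma sum_card_nbhd:
  assumes "simple_graph V E"
  shows "(\<Sum>v\<in>V. card (nbhd V E v)) = 2 * card E"
proof -
  have fin: "finite V" "finite E" and E: "\<And>e. e \<in> E \<Longrightarrow> e \<subseteq> V \<and> card e = 2"
    using assms finite_subset[of E "Pow V"] unfolding simple_graph_def by auto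
  have "card (nbhd V E v) = card {e \<in> E. v \<in> e}" if "v \<in> V" for v
  proof (rule bij_betw_same_card[of "\<lambda>u. {u, v}"], unfold bij_betw_def, intro conjI)
    show "inj_on (\<lambda>u. {u, v}) (nbhd V E v)" by (auto simp: inj_on_def doubleton_eq_iff)
    have "\<exists>u. e = {u, v}" if "e \<in> E" "v \<in> e" for e
      using E[of e] that by (auto simp: card_2_iff)
    then show "(\<lambda>u. {u, v}) ` nbhd V E v = {e \<in> E. v \<in> e}"
      using E unfolding nbhd_def by fastforce
  qed
  then have "(\<Sum>v\<in>V. card (nbhd V E v)) = (\<Sum>v\<in>V. card {e \<in> E. v \<in> e})" by simp
  also have "\<dots> = 2 * card E"
  proof (rule sum_multicount[OF fin])
    show "\<forall>e\<in>E. card {v \<in> V. v \<in> e} = 2"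
    proof
      fix e assume "e \<in> E"
      with E[of e] have "{v \<in> V. v \<in> e} = e" "card e = 2" by auto
      then show "card {v \<in> V. v \<in> e} = 2" by simp
    qed
  qed
  finally show ?thesis .
qed

lemma lexbfs_ordering_labels:
  assumes inv: "inverse_arrays n ord pos" and L: "labels (\<lambda>u v. {u, v} \<in> E) n n ord cls"
  shows "distinct (map ord [0..<n])" "set (map ord [0..<n]) = {..<n}"
    "lexbfs_ordering E (map ord [0..<n])"
proof -
  show "distinct (map ord [0..<n])"
    using inv unfolding inverse_arrays_def by (auto simp: distinct_map intro!: inj_onI) metis
  show "set (map ord [0..<n]) = {..<n}"
    using inv unfolding inverse_arrays_def by (auto simp: image_iff) (metis atLeastLessThan_iff le0)
  have *: "\<exists>d<a. {ord d, ord b} \<in> E \<and> {ord d, ord c} \<notin> E"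
    if "a < b" "b < c" "c < n" "{ord a, ord c} \<in> E" "{ord a, ord b} \<notin> E" for a b c
    using L that unfolding labels_def by (meson order.strict_trans)
  show "lexbfs_ordering E (map ord [0..<n])"
    unfolding lexbfs_ordering_def
  proof (intro allI impI)
    fix a b c
    let ?vs = "map ord [0..<n]"
    assume abc: "a < b" "b < c" "c < length ?vs" "{?vs ! a, ?vs ! c} \<in> E" "{?vs ! a, ?vs ! b} \<notin> E"
    with *[of a b c] obtain d where "d < a" "{ord d, ord b} \<in> E" "{ord d, ord c} \<notin> E" by auto
    with abc show "\<exists>d<a. {?vs ! d, ?vs ! b} \<in> E \<and> {?vs ! d, ?vs ! c} \<notin> E"
      by (intro exI[of _ d]) auto
  qed
qed

theorem theorem5p5:
  "(\<forall>(V :: 'a set) E. simple_graph V E \<and> hole_cyclically_orientable E \<longrightarrow>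
      (\<exists>v\<in>V. bisimplicial V E v)) \<and>
   linear_time_computable (\<lambda>V E. hole_cyclically_orientable E) bisimplicial_elimination_ordering"
proof (intro conjI allI impI)
  fix V :: "'a set" and E
  assume *: "simple_graph V E \<and> hole_cyclically_orientable E"
  then obtain vs where vs: "distinct vs" "set vs = V" "lexbfs_ordering E vs"
    using lexbfs_ordering_exists[of V E] by (auto simp: simple_graph_def)
  with * have "bisimplicial V E (last vs)" using lexbfs_last_bisimplicial[of vs E] by simp
  then show "\<exists>v\<in>V. bisimplicial V E v" unfolding bisimplicial_def by blast
next
  show "linear_time_computable (\<lambda>V E. hole_cyclically_orientable E) bisimplicial_elimination_ordering"
    unfolding linear_time_computable_def
  \<comment> \<open>One number serves as time factor and as exponent of the word bound, and the time
    dictates it: at most \<open>20 * n + 10\<close> steps for initialisation, 2 for the assignment,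
    and \<open>80 * n + 160 * card E + 10\<close> for the main loop, where \<open>n > 0\<close>
    absorbs the constants. For the words, already the square exceeds
    \<open>n + 2 * card E\<close>.\<close>
  proof (rule exI[of _ lexbfs_program], rule exI[of _ 300], intro allI impI)
    fix n E adj
    assume "simple_graph {..<n} E \<and> hole_cyclically_orientable E \<and> adjacency_lists n E adj"
    then have G: "simple_graph {..<n} E" and hc: "hole_cyclically_orientable E"
      and n: "length adj = n"
      and adj: "\<And>v. v < n \<Longrightarrow> distinct (adj ! v) \<and> set (adj ! v) = nbhd {..<n} E v"
      by (auto simp: adjacency_lists_def)
    let ?s = "initial_state adj" and ?T = "300 * (n + card E)"
    define w where "w = (n + card E + 1) ^ 300"
    have "n > 0" using G by (auto simp: simple_graph_def)
    have "length (concat adj) = (\<Sum>v<n. length (adj ! v))"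
      using n by (simp add: length_concat sum_list_sum_nth atLeast0LessThan)
    also have "\<dots> = (\<Sum>v<n. card (nbhd {..<n} E v))"
      using adj by (intro sum.cong) (auto simp flip: distinct_card)
    finally have m: "length (concat adj) = 2 * card E" using sum_card_nbhd[OF G] by simp
    have "n + 2 * card E + 1 \<le> (n + card E + 1) ^ 2" by (simp add: power2_eq_square algebra_simps)
    also have "\<dots> \<le> w" unfolding w_def by (rule power_increasing) auto
    finally have w: "n + 2 * card E < w" by simp
    have "runs w lexbfs_program ?s ?T (\<lambda>s T. bisimplicial_elimination_ordering {..<n} E (output_list s))"
      unfolding lexbfs_program_def
    proof (intro runs_Seq runs_init[where n = n])
      fix s :: state and T assume s: "reg s = (reg ?s)(1 := n)"
         "arr s = (arr ?s)(2 := (\<lambda>x. if x < n then x else arr ?s 2 x), 3 := (\<lambda>x. if x < n then x else arr ?s 3 x))"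
         "?T \<le> T + 20 * n + 10"
      show "runs w (Assign 1 (Lit 0)) s T (\<lambda>s T. runs w lexbfs_main s T
         (\<lambda>s T. bisimplicial_elimination_ordering {..<n} E (output_list s)))"
      proof (intro runs_Assign runs_main[where adj = adj and P = "\<lambda>u v. {u, v} \<in> E"], unfold n)
        fix s' :: state
        assume "reg s' 0 = n" and "inverse_arrays n (arr s' 2) (arr s' 3)"
          and "labels (\<lambda>u v. {u, v} \<in> E) n n (arr s' 2) (arr s' 4)"
        then show "bisimplicial_elimination_ordering {..<n} E (output_list s')"
          using lexbfs_bisimplicial_elimination_ordering[OF G hc] lexbfs_ordering_labels
          unfolding output_list_def by metis
      qed (use s w m adj \<open>n > 0\<close> n in \<open>auto simp: initial_state_def nbhd_def inverse_arrays_def insert_commute\<close>)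
    qed (use n w \<open>n > 0\<close> in \<open>auto simp: initial_state_def\<close>)
    then show "\<exists>t s. exec ((n + card E + 1) ^ 300) lexbfs_program ?s t s \<and> t \<le> ?T \<and>
        bisimplicial_elimination_ordering {..<n} E (output_list s)"
      unfolding runs_def w_def by blast
  qed
qed

end
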